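(* Assume that the following hypothesis (a conjecture of the paper) holds: for every odd integer $m'\geq 3$ there exists a normalized Hadamard matrix of order $4m'$ such that, after deleting its first column and replacing each $-1$ by $0$, some $8$ columns of the resulting OA$(4m',4m'-1,2,2)$ form an OA$(4m',8,2,2)$ that has two subsets $V$ and $W$ of its set of column vectors satisfying (1) $|V|,|W|\geq 3$; (2) there exist ${\bf v}\in V\setminus W$ and ${\bf w}\in W\setminus V$ such that $V\setminus\{{\bf v}\}\neq W\setminus\{{\bf w}\}$; (3) $\sum_{{\bf x}\in V}{\bf x}$ is orthogonal to $\sum_{{\bf y}\in W}{\bf y}$ (sums over $\mathbb{F}_2$). Let $m$ and $b$ be odd positive integers, and let $a\ge 0$ and $k$ be integers. Then an array of type $I_k(4m,2^ab,2,2)$ exists if and only if $(k,4m,2^ab,2,2)$ is admissible and $$(k,4m,2^ab,2,2)\notin\{(3,4c,4,2,2),(3,4,4c,2,2)\mid c \text{ is odd}\}.$$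
   Context: For an integer $s\ge 1$ let $[s]=\{0,1,\dots,s-1\}$. An orthogonal array OA$(n,k,q,t)$ (size $n$, degree $k$, $q$ levels, strength $t$, $1\le t\leq k$) is an $n\times k$ array with entries from $[q]$ such that in every $n\times t$ submatrix (choice of $t$ columns), every vector of $[q]^t$ appears as a row exactly $n/q^t$ times. An array of type $I_k(m,n,q,t)$ (an $m\times n$ row-column factorial design $q^k$ of strength $t$) is an $m\times n$ array whose cells each contain a vector of $[q]^k$ such that: (i) each vector of $[q]^k$ occurs in exactly $\lambda=mn/q^k$ cells (so $q^k\mid mn$); (ii) for each row of the array, the $n$ vectors in that row are the rows of an OA$(n,k,q,t)$; (iii) for each column of the array, the $m$ vectors in that column are the rows of an OA$(m,k,q,t)$. A 5-tuple $(k,m,n,q,t)$ is admissible if $q^k\mid mn$, there exists an OA$(m,k,q,t)$, and there exists an OA$(n,k,q,t)$. A Hadamard matrix of order $n$ is an $n\times n$ matrix $H$ with entries in $\{1,-1\}$ and $HH^T=nI_n$; it is normalized if its first row and first column contain only the entry $1$. Two binary vectors ${\bf v},{\bf w}$ of length $4\ell$ are called orthogonal if each has weight (number of $1$'s) equal to $2\ell$ and the number of positions where both are $1$ is $\ell$. *)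

theory Defs
  imports "Jordan_Normal_Form.Matrix" "Jordan_Normal_Form.DL_Submatrix"
begin

definition words :: "nat \<Rightarrow> nat \<Rightarrow> nat vec set" where
  "words q k = {v \<in> carrier_vec k. \<forall>j<k. v $ j < q}"

text \<open>
  The frequencies \<open>n / q ^ t\<close> (here) and \<open>m n / q ^ k\<close> (below) are stated in multiplied-out form,
  so that the divisibility is part of the definition.
\<close>

definition is_OA :: "nat \<Rightarrow> nat \<Rightarrow> nat \<Rightarrow> nat \<Rightarrow> nat mat \<Rightarrow> bool" where
  "is_OA n k q t A \<longleftrightarrow>
     q \<ge> 1 \<and> 1 \<le> t \<and> t \<le> k \<and> A \<in> carrier_mat n k \<and>
     (\<forall>i<n. \<forall>j<k. A $$ (i, j) < q) \<and>
     (\<forall>J \<subseteq> {..<k}. card J = t \<longrightarrow>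
        (\<forall>v \<in> words q t. card {i. i < n \<and> row (submatrix A UNIV J) i = v} * q ^ t = n))"

text \<open>
  An array of type \<open>I\<^sub>k(m, n, q, t)\<close> is a matrix whose cells are vectors. The cells of one of its
  rows (columns) are listed as the rows of a number matrix with \<open>k\<close> columns.
\<close>

definition row_array :: "nat \<Rightarrow> nat vec mat \<Rightarrow> nat \<Rightarrow> nat mat" where
  "row_array k A i = mat (dim_col A) k (\<lambda>(j, l). A $$ (i, j) $ l)"

definition col_array :: "nat \<Rightarrow> nat vec mat \<Rightarrow> nat \<Rightarrow> nat mat" where
  "col_array k A j = mat (dim_row A) k (\<lambda>(i, l). A $$ (i, j) $ l)"

definition is_I_array :: "nat \<Rightarrow> nat \<Rightarrow> nat \<Rightarrow> nat \<Rightarrow> nat \<Rightarrow> nat vec mat \<Rightarrow> bool" where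
  "is_I_array k m n q t A \<longleftrightarrow>
     A \<in> carrier_mat m n \<and>
     (\<forall>i<m. \<forall>j<n. A $$ (i, j) \<in> words q k) \<and>
     (\<forall>v \<in> words q k. card {(i, j). i < m \<and> j < n \<and> A $$ (i, j) = v} * q ^ k = m * n) \<and>
     (\<forall>i<m. is_OA n k q t (row_array k A i)) \<and>
     (\<forall>j<n. is_OA m k q t (col_array k A j))"

fun admissible :: "nat \<times> nat \<times> nat \<times> nat \<times> nat \<Rightarrow> bool" where
  "admissible (k, m, n, q, t) \<longleftrightarrow>
     q ^ k dvd m * n \<and> (\<exists>A. is_OA m k q t A) \<and> (\<exists>A. is_OA n k q t A)"

definition hadamard :: "nat \<Rightarrow> int mat \<Rightarrow> bool" where
  "hadamard n H \<longleftrightarrow>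
     H \<in> carrier_mat n n \<and> (\<forall>i<n. \<forall>j<n. H $$ (i, j) \<in> {1, -1}) \<and>
     H * transpose_mat H = int n \<cdot>\<^sub>m 1\<^sub>m n"

definition normalized :: "int mat \<Rightarrow> bool" where
  "normalized H \<longleftrightarrow>
     (\<forall>j < dim_col H. H $$ (0, j) = 1) \<and> (\<forall>i < dim_row H. H $$ (i, 0) = 1)"

text \<open>Deletes the first column and replaces each \<open>-1\<close> by \<open>0\<close>.\<close>

definition hadamard_OA :: "int mat \<Rightarrow> nat mat" where
  "hadamard_OA H =
     mat (dim_row H) (dim_col H - 1) (\<lambda>(i, j). if H $$ (i, Suc j) = -1 then 0 else 1)"

text \<open>The field with two elements is identified with \<open>{0, 1}\<close>, addition being modulo 2.\<close>

definition sum_mod2 :: "nat \<Rightarrow> nat vec set \<Rightarrow> nat vec" where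
  "sum_mod2 n V = vec n (\<lambda>i. (\<Sum>x\<in>V. x $ i) mod 2)"

definition weight :: "nat vec \<Rightarrow> nat" where
  "weight v = card {i. i < dim_vec v \<and> v $ i = 1}"

definition orthogonal_binary :: "nat vec \<Rightarrow> nat vec \<Rightarrow> bool" where
  "orthogonal_binary v w \<longleftrightarrow>
     (\<exists>l. v \<in> words 2 (4 * l) \<and> w \<in> words 2 (4 * l) \<and>
          weight v = 2 * l \<and> weight w = 2 * l \<and>
          card {i. i < 4 * l \<and> v $ i = 1 \<and> w $ i = 1} = l)"

text \<open>
  \<open>J\<close> is the choice of 8 columns. The columns of a Hadamard matrix are pairwise distinct, so
  \<open>set (cols B)\<close> has exactly 8 elements.
\<close>

definition good_hadamard_order :: "nat \<Rightarrow> bool" where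
  "good_hadamard_order m' \<longleftrightarrow>
     (\<exists>H J B V W.
        hadamard (4 * m') H \<and> normalized H \<and>
        J \<subseteq> {..<4 * m' - 1} \<and> card J = 8 \<and>
        B = submatrix (hadamard_OA H) UNIV J \<and> is_OA (4 * m') 8 2 2 B \<and>
        V \<subseteq> set (cols B) \<and> W \<subseteq> set (cols B) \<and>
        card V \<ge> 3 \<and> card W \<ge> 3 \<and>
        (\<exists>v \<in> V - W. \<exists>w \<in> W - V. V - {v} \<noteq> W - {w}) \<and>
        orthogonal_binary (sum_mod2 (4 * m') V) (sum_mod2 (4 * m') W))"

end

(* Idea. Track two strengths at once: a design (m, n, s, k) has cells in F_2^k, rows of strength 2 on
   the first s coordinates, columns of strength 2 on all k, and each vector of F_2^s equally often.
   Designs can be stacked, and placing a copy with coordinate s complemented next to a design with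
   s < k gives (m, 2n, s+1, k). For k <= 7 this reduces everything to four small tables of sizes 4x4,
   8x8, 12x8 and 12x12, since 4m = 12 + 8r. For k >= 8 let r_i be the rows of k columns of the
   Hadamard OA that include the eight good ones, and C the code of vectors of F_2^k with even parity
   on V and on W; then r_i + c (c in C) is an array of type I_k(4m, 2^(k-2)). Condition (3) says that
   the r_i meet the four cosets of C equally often; (1) and (2) say that C has dual distance at least
   three, i.e. strength 2. Conversely, divisibility and the Rao bound k < 4m limit k, and a parity
   argument excludes I_3(4c, 4) for odd c. *)

theory Submission
  imports Defs "Jordan_Normal_Form.Determinant"
begin

text \<open>The asymmetry between s and k comes from doubling: it adds one word to all cells of a
  column, which cannot destroy the strength of that column but cannot create any either. So columns
  must have strength 2 on all k coordinates from the start, while s grows with the number of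
  columns. The table sizes follow. For odd m the largest power of two dividing 4m * 8 is 2^5, hence
  s = 5, and each doubling raises by one both a and the bound k \<le> a + 2. Columns of length 8
  have strength 2 on at most 7 coordinates, so stacking blocks of 12 and 8 rows stops at k = 7;
  larger k are built from a Hadamard matrix of order 4m itself. For a = 2 both sides are four times
  an odd number, and the 12x12 table supplies the odd block in both directions. For m = 1 columns
  have length four and k \<le> 3, which the 4x4 table covers.\<close>

definition strength2 :: "'a set \<Rightarrow> nat \<Rightarrow> ('a \<Rightarrow> nat \<Rightarrow> bool) \<Rightarrow> bool" where
  "strength2 I s f \<longleftrightarrow> (\<forall>l<s. \<forall>l'<s. l \<noteq> l' \<longrightarrow>
     (\<forall>x y. 4 * card {i \<in> I. f i l = x \<and> f i l' = y} = card I))"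

text \<open>Index sets are arbitrary finite sets, so that a code can index the columns in the
  construction from Hadamard matrices. Only the case s = k is symmetric in rows and columns.\<close>

definition design :: "'a set \<Rightarrow> 'b set \<Rightarrow> nat \<Rightarrow> nat \<Rightarrow> ('a \<Rightarrow> 'b \<Rightarrow> nat \<Rightarrow> bool) \<Rightarrow> bool" where
  "design I J s k F \<longleftrightarrow> finite I \<and> finite J \<and> s \<le> k \<and>
     (\<forall>i\<in>I. strength2 J s (F i)) \<and> (\<forall>j\<in>J. strength2 I k (\<lambda>i. F i j)) \<and>
     (\<forall>v. 2 ^ s * card {(i, j). i \<in> I \<and> j \<in> J \<and> (\<forall>l<s. F i j l = v l)} = card I * card J)"

definition design_exists :: "nat \<Rightarrow> nat \<Rightarrow> nat \<Rightarrow> nat \<Rightarrow> bool" where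
  "design_exists m n s k \<longleftrightarrow> (\<exists>F. design {..<m} {..<n} s k F)"

section \<open>Elementary properties of strength 2\<close>

lemma strength2D:
  "strength2 I s f \<Longrightarrow> l < s \<Longrightarrow> l' < s \<Longrightarrow> l \<noteq> l' \<Longrightarrow>
    4 * card {i \<in> I. f i l = x \<and> f i l' = y} = card I"
  unfolding strength2_def by blast

lemma strength2_mono: "strength2 I s f \<Longrightarrow> s' \<le> s \<Longrightarrow> strength2 I s' f"
  unfolding strength2_def by auto

lemma strength2_cong:
  assumes "\<And>i l. i \<in> I \<Longrightarrow> l < s \<Longrightarrow> f i l = g i l"
  shows "strength2 I s f = strength2 I s g"
proof -
  have "{i \<in> I. f i l = x \<and> f i l' = y} = {i \<in> I. g i l = x \<and> g i l' = y}"
    if "l < s" "l' < s" for l l' x y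
    using assms that by auto
  then show ?thesis unfolding strength2_def by simp
qed

lemma card_Collect_bij_betw:
  assumes "bij_betw h A B"
  shows "card {a \<in> A. P (h a)} = card {b \<in> B. P b}"
proof -
  have "bij_betw h {a \<in> A. P (h a)} {b \<in> B. P b}"
    using assms unfolding bij_betw_def inj_on_def by auto
  then show ?thesis by (rule bij_betw_same_card)
qed

lemma strength2_bij_betw:
  assumes "bij_betw h I I'" "strength2 I' s f"
  shows "strength2 I s (\<lambda>i. f (h i))"
  using assms(2) card_Collect_bij_betw[OF assms(1), of "\<lambda>i. f i l = x \<and> f i l' = y" for l l' x y] bij_betw_same_card[OF assms(1)]
  unfolding strength2_def by simp

lemma strength2_Un:
  assumes "strength2 I s f" "strength2 I' s f" "I \<inter> I' = {}" "finite I" "finite I'"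
  shows "strength2 (I \<union> I') s f"
  unfolding strength2_def
proof (intro allI impI)
  fix l l' x y assume *: "l < s" "l' < s" "l \<noteq> l'"
  have "{i \<in> I \<union> I'. f i l = x \<and> f i l' = y} =
      {i \<in> I. f i l = x \<and> f i l' = y} \<union> {i \<in> I'. f i l = x \<and> f i l' = y}" by auto
  moreover have "card \<dots> = card {i \<in> I. f i l = x \<and> f i l' = y} + card {i \<in> I'. f i l = x \<and> f i l' = y}"
    using assms by (intro card_Un_disjoint) auto
  ultimately show "4 * card {i \<in> I \<union> I'. f i l = x \<and> f i l' = y} = card (I \<union> I')"
    using strength2D[OF assms(1) *, of x y] strength2D[OF assms(2) *, of x y]
      card_Un_disjoint[OF assms(4,5,3)] by simp
qed

text \<open>Adding a fixed word \<open>e\<close> only permutes the value pairs of each two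
  coordinates. This serves the complemented copies in doubling as well as the translates of a
  code.\<close>

lemma strength2_flip:
  assumes "strength2 I s f" "\<And>i. i \<in> I \<Longrightarrow> \<forall>l<s. g i l = (f i l \<noteq> e l)"
  shows "strength2 I s g"
  unfolding strength2_def
proof (intro allI impI)
  fix l l' x y assume *: "l < s" "l' < s" "l \<noteq> l'"
  have "{i \<in> I. g i l = x \<and> g i l' = y} = {i \<in> I. f i l = (x \<noteq> e l) \<and> f i l' = (y \<noteq> e l')}"
    using assms(2) * by auto
  then show "4 * card {i \<in> I. g i l = x \<and> g i l' = y} = card I"
    using strength2D[OF assms(1) *] by simp
qed

text \<open>Sum over the values of a second coordinate. It must exist: for s = 1 the predicate
  \<open>strength2\<close> is vacuous.\<close>

lemma strength2_strength1:
  assumes "strength2 I s f" "finite I" "2 \<le> s" "l < s"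
  shows "2 * card {i \<in> I. f i l = x} = card I"
proof -
  obtain l' where l': "l' < s" "l \<noteq> l'"
    using assms by (metis One_nat_def Suc_1 Suc_le_lessD less_2_cases_iff not_less_eq_eq
        order_less_le_trans zero_less_Suc zero_neq_one lessI)
  have "{i \<in> I. f i l = x} = {i \<in> I. f i l = x \<and> f i l' = True} \<union> {i \<in> I. f i l = x \<and> f i l' = False}"
    by auto
  moreover have "card \<dots> = card {i \<in> I. f i l = x \<and> f i l' = True} + card {i \<in> I. f i l = x \<and> f i l' = False}"
    using assms by (intro card_Un_disjoint) auto
  ultimately show ?thesis
    using strength2D[OF assms(1,4) l', of x True] strength2D[OF assms(1,4) l', of x False] by simp
qed

section \<open>Relabelling, transposing, stacking and restricting designs\<close>

lemma design_bij_betw: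
  assumes "bij_betw g I I'" "bij_betw h J J'" "design I' J' s k F"
  shows "design I J s k (\<lambda>i j. F (g i) (h j))"
proof -
  have "bij_betw (map_prod g h) (I \<times> J) (I' \<times> J')"
    using assms(1,2) by (rule bij_betw_map_prod)
  from card_Collect_bij_betw[OF this]
  have "card {p \<in> I \<times> J. P (map_prod g h p)} = card {p \<in> I' \<times> J'. P p}" for P .
  from this[of "\<lambda>(i, j). \<forall>l<s. F i j l = v l" for v]
  have "card {(i, j). i \<in> I \<and> j \<in> J \<and> (\<forall>l<s. F (g i) (h j) l = v l)} =
      card {(i, j). i \<in> I' \<and> j \<in> J' \<and> (\<forall>l<s. F i j l = v l)}" for v
    by (simp add: case_prod_unfold mem_Times_iff conj_assoc)
  moreover have "strength2 I k (\<lambda>i. F (g i) (h j))" if "j \<in> J" for j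
    using assms that strength2_bij_betw[OF assms(1), of k "\<lambda>i. F i (h j)"] bij_betwE[OF assms(2)]
    unfolding design_def by blast
  ultimately show ?thesis
    using assms bij_betw_finite[OF assms(1)] bij_betw_finite[OF assms(2)]
      bij_betw_same_card[OF assms(1)] bij_betw_same_card[OF assms(2)]
      strength2_bij_betw[OF assms(2)] bij_betwE[OF assms(1)]
    unfolding design_def by simp
qed

lemma design_imp_design_exists:
  assumes "design I J s k F"
  shows "design_exists (card I) (card J) s k"
proof -
  have "finite I" "finite J" using assms unfolding design_def by auto
  then obtain g h where "bij_betw g {..<card I} I" "bij_betw h {..<card J} J"
    using ex_bij_betw_nat_finite unfolding atLeast0LessThan by metis
  then show ?thesis
    unfolding design_exists_def using design_bij_betw assms by blast
qed

lemma design_transpose: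
  assumes "design I J k k F"
  shows "design J I k k (\<lambda>j i. F i j)"
proof -
  have "card {(j, i). j \<in> J \<and> i \<in> I \<and> Q i j} = card {(i, j). i \<in> I \<and> j \<in> J \<and> Q i j}" for Q
  proof -
    have "{(j, i). j \<in> J \<and> i \<in> I \<and> Q i j} = prod.swap ` {(i, j). i \<in> I \<and> j \<in> J \<and> Q i j}"
      by force
    then show ?thesis by (simp add: card_image)
  qed
  then show ?thesis using assms unfolding design_def by (simp add: mult.commute)
qed

lemma design_exists_transpose: "design_exists m n k k \<Longrightarrow> design_exists n m k k"
  unfolding design_exists_def using design_transpose by blast

lemma card_pairs_split:
  assumes "finite I" "finite J" "finite J'" "J \<inter> J' = {}"
  shows "card {(i, j). i \<in> I \<and> j \<in> J \<union> J' \<and> Q i j} =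
    card {(i, j). i \<in> I \<and> j \<in> J \<and> Q i j} + card {(i, j). i \<in> I \<and> j \<in> J' \<and> Q i j}"
proof -
  have "{(i, j). i \<in> I \<and> j \<in> J \<union> J' \<and> Q i j} =
    {(i, j). i \<in> I \<and> j \<in> J \<and> Q i j} \<union> {(i, j). i \<in> I \<and> j \<in> J' \<and> Q i j}" by auto
  moreover have "finite {(i, j). i \<in> I \<and> j \<in> K \<and> Q i j}" if "finite K" for K
    by (rule finite_subset[of _ "I \<times> K"]) (use assms(1) that in auto)
  ultimately show ?thesis
    using assms by (subst card_Un_disjoint[symmetric]) auto
qed

lemma design_stack_columns:
  assumes "design I J s k F" "design I J' s k F" "J \<inter> J' = {}"
  shows "design I (J \<union> J') s k F"
  using assms card_pairs_split[of I J J'] strength2_Un[of J s _ J'] card_Un_disjoint[of J J']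
  unfolding design_def by (auto simp: distrib_left)

lemma design_cong:
  assumes "\<And>i j l. i \<in> I \<Longrightarrow> j \<in> J \<Longrightarrow> l < k \<Longrightarrow> F i j l = G i j l"
  shows "design I J s k F = design I J s k G"
proof (cases "s \<le> k")
  case True
  have "strength2 J s (F i) = strength2 J s (G i)" if "i \<in> I" for i
    by (rule strength2_cong) (use assms that True in auto)
  moreover have "strength2 I k (\<lambda>i. F i j) = strength2 I k (\<lambda>i. G i j)" if "j \<in> J" for j
    by (rule strength2_cong) (use assms that True in auto)
  moreover have "{(i, j). i \<in> I \<and> j \<in> J \<and> (\<forall>l<s. F i j l = v l)} =
      {(i, j). i \<in> I \<and> j \<in> J \<and> (\<forall>l<s. G i j l = v l)}" for v
    using assms True by auto
  ultimately show ?thesis unfolding design_def by auto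
qed (simp add: design_def)

lemma design_exists_add_columns:
  assumes "design_exists m n s k" "design_exists m n' s k"
  shows "design_exists m (n + n') s k"
proof -
  obtain F G where F: "design {..<m} {..<n} s k F" and G: "design {..<m} {..<n'} s k G"
    using assms unfolding design_exists_def by blast
  define H where "H i j = (if j < n then F i j else G i (j - n))" for i j
  have "bij_betw (\<lambda>j. j - n) {n..<n + n'} {..<n'}"
    by (rule bij_betw_byWitness[where f' = "\<lambda>j. j + n"]) auto
  from design_bij_betw[OF bij_betw_id this G]
  have "design {..<m} {n..<n + n'} s k H"
    by (subst design_cong[where G = "\<lambda>i j. G (id i) (j - n)"]) (auto simp: H_def)
  moreover have "design {..<m} {..<n} s k H"
    using F by (subst design_cong[where G = F]) (auto simp: H_def)
  ultimately have "design {..<m} ({..<n} \<union> {n..<n + n'}) s k H"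
    by (intro design_stack_columns) auto
  moreover have "{..<n} \<union> {n..<n + n'} = {..<n + n'}" by auto
  ultimately show ?thesis unfolding design_exists_def by auto
qed

lemma card_pairs_split_rows:
  assumes "finite I" "finite I'" "finite J" "I \<inter> I' = {}"
  shows "card {(i, j). i \<in> I \<union> I' \<and> j \<in> J \<and> Q i j} =
    card {(i, j). i \<in> I \<and> j \<in> J \<and> Q i j} + card {(i, j). i \<in> I' \<and> j \<in> J \<and> Q i j}"
proof -
  have "{(i, j). i \<in> I \<union> I' \<and> j \<in> J \<and> Q i j} =
    {(i, j). i \<in> I \<and> j \<in> J \<and> Q i j} \<union> {(i, j). i \<in> I' \<and> j \<in> J \<and> Q i j}" by auto
  moreover have "finite {(i, j). i \<in> K \<and> j \<in> J \<and> Q i j}" if "finite K" for K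
    by (rule finite_subset[of _ "K \<times> J"]) (use assms(3) that in auto)
  ultimately show ?thesis
    using assms by (subst card_Un_disjoint[symmetric]) auto
qed

lemma design_stack_rows:
  assumes "design I J s k F" "design I' J s k F" "I \<inter> I' = {}"
  shows "design (I \<union> I') J s k F"
  using assms card_pairs_split_rows[of I I' J] strength2_Un[of I k _ I'] card_Un_disjoint[of I I']
  unfolding design_def by (auto simp: distrib_left distrib_right)

lemma design_exists_add_rows:
  assumes "design_exists m n s k" "design_exists m' n s k"
  shows "design_exists (m + m') n s k"
proof -
  obtain F G where F: "design {..<m} {..<n} s k F" and G: "design {..<m'} {..<n} s k G"
    using assms unfolding design_exists_def by blast
  define H where "H i = (if i < m then F i else G (i - m))" for i
  have "bij_betw (\<lambda>i. i - m) {m..<m + m'} {..<m'}"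
    by (rule bij_betw_byWitness[where f' = "\<lambda>i. i + m"]) auto
  from design_bij_betw[OF this bij_betw_id G]
  have "design {m..<m + m'} {..<n} s k H"
    by (subst design_cong[where G = "\<lambda>i j. G (i - m) (id j)"]) (auto simp: H_def)
  moreover have "design {..<m} {..<n} s k H"
    using F by (subst design_cong[where G = F]) (auto simp: H_def)
  ultimately have "design ({..<m} \<union> {m..<m + m'}) {..<n} s k H"
    by (intro design_stack_rows) auto
  moreover have "{..<m} \<union> {m..<m + m'} = {..<m + m'}" by auto
  ultimately show ?thesis unfolding design_exists_def by auto
qed

lemma design_exists_mult_columns:
  assumes "design_exists m n s k" "0 < c"
  shows "design_exists m (c * n) s k"
  using assms(2)
proof (induction c rule: nat_induct_non_zero)
  case (Suc c)
  then show ?case using design_exists_add_columns[OF assms(1)] by simp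
qed (use assms(1) in simp)

lemma design_exists_mult_rows:
  assumes "design_exists m n s k" "0 < c"
  shows "design_exists (c * m) n s k"
  using assms(2)
proof (induction c rule: nat_induct_non_zero)
  case (Suc c)
  then show ?case using design_exists_add_rows[OF assms(1)] by simp
qed (use assms(1) in simp)

lemma design_mono_columns: "design I J s k F \<Longrightarrow> s \<le> k' \<Longrightarrow> k' \<le> k \<Longrightarrow> design I J s k' F"
  unfolding design_def using strength2_mono by blast

lemma card_pairs_split_coordinate:
  assumes "finite I" "finite J"
  shows "card {(i, j). i \<in> I \<and> j \<in> J \<and> (\<forall>l<s. F i j l = v l)} =
    card {(i, j). i \<in> I \<and> j \<in> J \<and> (\<forall>l<Suc s. F i j l = (v(s := True)) l)} +
    card {(i, j). i \<in> I \<and> j \<in> J \<and> (\<forall>l<Suc s. F i j l = (v(s := False)) l)}"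
proof -
  have "{(i, j). i \<in> I \<and> j \<in> J \<and> (\<forall>l<s. F i j l = v l)} =
    {(i, j). i \<in> I \<and> j \<in> J \<and> (\<forall>l<Suc s. F i j l = (v(s := True)) l)} \<union>
    {(i, j). i \<in> I \<and> j \<in> J \<and> (\<forall>l<Suc s. F i j l = (v(s := False)) l)}"
    by (auto simp: less_Suc_eq)
  moreover have "finite {(i, j). i \<in> I \<and> j \<in> J \<and> Q i j}" for Q
    by (rule finite_subset[of _ "I \<times> J"]) (use assms in auto)
  ultimately show ?thesis
    by (subst card_Un_disjoint[symmetric]) (auto simp: less_Suc_eq)
qed

text \<open>A word on s coordinates has two extensions by coordinate s, and their frequencies add
  up.\<close>

lemma design_Suc:
  assumes "design I J (Suc s) k F"
  shows "design I J s k F"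
proof -
  have fin: "finite I" "finite J" using assms unfolding design_def by auto
  have *: "2 ^ Suc s * card {(i, j). i \<in> I \<and> j \<in> J \<and> (\<forall>l<Suc s. F i j l = v l)} = card I * card J" for v
    using assms unfolding design_def by blast
  have "2 ^ s * card {(i, j). i \<in> I \<and> j \<in> J \<and> (\<forall>l<s. F i j l = v l)} = card I * card J" for v
    using card_pairs_split_coordinate[OF fin, of s F v] *[of "v(s := True)"] *[of "v(s := False)"]
    by (simp add: distrib_left)
  then show ?thesis using assms strength2_mono unfolding design_def by fastforce
qed

lemma design_mono:
  assumes "design I J s k F" "s' \<le> s" "s' \<le> k'" "k' \<le> k"
  shows "design I J s' k' F"
proof -
  have "design I J s' k F" using assms(2,1)
    by (induction s' rule: inc_induct) (auto intro: design_Suc)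
  then show ?thesis using assms design_mono_columns by blast
qed

lemma design_exists_mono:
  "design_exists m n s k \<Longrightarrow> s' \<le> s \<Longrightarrow> s' \<le> k' \<Longrightarrow> k' \<le> k \<Longrightarrow> design_exists m n s' k'"
  unfolding design_exists_def using design_mono by blast

section \<open>Doubling the number of columns\<close>

text \<open>In each row, coordinate s takes each value on exactly one of the two copies of every
  column; it is thereby balanced against every earlier coordinate, whose own balance needs 2 \<le>
  s. The assumption s < k provides columns that already have strength 2 at coordinate s.\<close>

lemma design_double:
  fixes m n :: nat
  assumes F: "design {..<m} {..<n} s k F" and s: "2 \<le> s" "s < k"
  shows "\<exists>G. design {..<m} {..<2 * n} (Suc s) k G"
proof -
  \<comment> \<open>\<open>e j\<close> is the word added throughout column \<open>j\<close>, and
    \<open>r j\<close> is the column of which \<open>j\<close> is a copy.\<close>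
  define e where "e j l = (n \<le> j \<and> l = s)" for j l :: nat
  define r where "r j = (if j < n then j else j - n)" for j
  define G where "G i j l = (F i (r j) l \<noteq> e j l)" for i j l
  have rows: "strength2 {..<2 * n} (Suc s) (G i)" if i: "i < m" for i
  proof -
    have F_i: "strength2 {..<n} s (F i)" using F i unfolding design_def by simp
    have card_r: "card {j \<in> {..<2 * n}. P (r j) (n \<le> j)} =
        card {j \<in> {..<n}. P j False} + card {j \<in> {..<n}. P j True}" for P
    proof -
      define A B C where "A = {j \<in> {..<n}. P j False}" and "B = {j \<in> {..<n}. P j True}"
        and "C = {j \<in> {n..<2 * n}. P (r j) (n \<le> j)}"
      have "bij_betw (\<lambda>j. j + n) B C"
        by (rule bij_betw_byWitness[where f' = "\<lambda>j. j - n"]) (auto simp: r_def B_def C_def)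
      then have "card C = card B" by (rule bij_betw_same_card[symmetric])
      moreover have "{j \<in> {..<2 * n}. P (r j) (n \<le> j)} = A \<union> C"
        by (auto simp: r_def A_def C_def)
      moreover have "card (A \<union> C) = card A + card C"
        by (rule card_Un_disjoint) (auto simp: A_def C_def)
      ultimately show ?thesis by (simp add: A_def B_def)
    qed
    show ?thesis unfolding strength2_def
    proof (intro allI impI)
      fix l l' x y assume l: "l < Suc s" "l' < Suc s" "l \<noteq> l'"
      let ?A = "\<lambda>b. {j \<in> {..<n}. (F i j l \<noteq> (b \<and> l = s)) = x \<and> (F i j l' \<noteq> (b \<and> l' = s)) = y}"
      have "card {j \<in> {..<2 * n}. G i j l = x \<and> G i j l' = y} = card (?A False) + card (?A True)"
        using card_r[of "\<lambda>j b. (F i j l \<noteq> (b \<and> l = s)) = x \<and> (F i j l' \<noteq> (b \<and> l' = s)) = y"]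
        unfolding G_def e_def .
      also have "4 * \<dots> = 2 * n"
      proof (cases "l = s \<or> l' = s")
        case False
        then have "l < s" "l' < s" using l by auto
        then show ?thesis using strength2D[OF F_i _ _ l(3), of x y] False by simp
      next
        case True
        \<comment> \<open>\<open>p\<close> is the coordinate other than s and \<open>z\<close> its
          prescribed value. For each old column exactly one copy has the prescribed value at s, so
          only the condition at \<open>p\<close> is left.\<close>
        define p z where "p = (if l = s then l' else l)" and "z = (if l = s then y else x)"
        have p: "p < s" using True l by (auto simp: p_def)
        have "?A False \<union> ?A True = {j \<in> {..<n}. F i j p = z}" "?A False \<inter> ?A True = {}"
          using True l by (auto simp: p_def z_def)
        then have "card (?A False) + card (?A True) = card {j \<in> {..<n}. F i j p = z}"
          by (subst card_Un_disjoint[symmetric]) auto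
        then show ?thesis using strength2_strength1[OF F_i _ s(1) p, of z] by simp
      qed
      finally show "4 * card {j \<in> {..<2 * n}. G i j l = x \<and> G i j l' = y} = card {..<2 * n}"
        by simp
    qed
  qed
  have columns: "strength2 {..<m} k (\<lambda>i. G i j)" if j: "j < 2 * n" for j
  proof (rule strength2_flip[where e = "e j"])
    have "r j < n" using j by (auto simp: r_def)
    then show "strength2 {..<m} k (\<lambda>i. F i (r j))" using F unfolding design_def by simp
  qed (simp add: G_def)
  have uniform: "2 ^ Suc s * card {(i, j). i \<in> {..<m} \<and> j \<in> {..<2 * n} \<and> (\<forall>l<Suc s. G i j l = v l)}
      = m * (2 * n)" for v
  proof -
    have "bij_betw (\<lambda>(i, j). (i, r j))
        {(i, j). i \<in> {..<m} \<and> j \<in> {..<2 * n} \<and> (\<forall>l<Suc s. G i j l = v l)}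
        {(i, j). i \<in> {..<m} \<and> j \<in> {..<n} \<and> (\<forall>l<s. F i j l = v l)}"
      \<comment> \<open>The inverse map selects the one copy whose coordinate s agrees with
        \<open>v\<close>.\<close>
      by (rule bij_betw_byWitness[where f' = "\<lambda>(i, j). (i, if F i j s = v s then j else j + n)"])
        (auto simp: G_def e_def r_def less_Suc_eq split: if_splits)
    then have "card {(i, j). i \<in> {..<m} \<and> j \<in> {..<2 * n} \<and> (\<forall>l<Suc s. G i j l = v l)} =
        card {(i, j). i \<in> {..<m} \<and> j \<in> {..<n} \<and> (\<forall>l<s. F i j l = v l)}"
      by (rule bij_betw_same_card)
    then show ?thesis using F unfolding design_def by simp
  qed
  show ?thesis
    using rows columns uniform s unfolding design_def by (intro exI[of _ G]) auto
qed

lemma design_exists_double: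
  "design_exists m n s k \<Longrightarrow> 2 \<le> s \<Longrightarrow> s < k \<Longrightarrow> design_exists m (2 * n) (Suc s) k"
  unfolding design_exists_def using design_double by blast

section \<open>Designs given by tables, in executable form\<close>

definition balanced_bits :: "bool list \<Rightarrow> bool list \<Rightarrow> bool" where
  "balanced_bits us vs \<longleftrightarrow>
     list_all (\<lambda>p. 4 * count_list (zip us vs) p = length us)
       [(True, True), (True, False), (False, True), (False, False)]"

text \<open>Here \<open>sorted_wrt\<close> has nothing to do with sorting: it tests all pairs of
  coordinates l < l'. One order suffices, as the condition on a pair is symmetric.\<close>

definition balanced_words :: "nat \<Rightarrow> int list \<Rightarrow> bool" where
  "balanced_words s ws \<longleftrightarrow> sorted_wrt balanced_bits (map (\<lambda>l. map (\<lambda>w. bit w l) ws) [0..<s])"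

definition uniform_words :: "nat \<Rightarrow> int list \<Rightarrow> bool" where
  "uniform_words s ws \<longleftrightarrow> list_all (\<lambda>w. 2 ^ s * count_list ws w = length ws) (map int [0..<2 ^ s])"

text \<open>Cells are integers whose bit \<open>l\<close> is coordinate \<open>l\<close>.\<close>

definition table_design :: "nat \<Rightarrow> nat \<Rightarrow> nat \<Rightarrow> nat \<Rightarrow> int list list \<Rightarrow> bool" where
  "table_design m n s k D \<longleftrightarrow>
     s \<le> k \<and> length D = m \<and> list_all (\<lambda>ws. length ws = n) D \<and>
     list_all (balanced_words s) D \<and>
     list_all (\<lambda>j. balanced_words k (map (\<lambda>ws. ws ! j) D)) [0..<n] \<and>
     uniform_words s (map (take_bit s) (concat D))"

lemma count_list_eq_card: "count_list xs x = card {i \<in> {..<length xs}. xs ! i = x}"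
  by (simp add: count_list_eq_length_filter length_filter_conv_card eq_commute)

lemma strength2_balanced_words:
  assumes "balanced_words s ws"
  shows "strength2 {..<length ws} s (\<lambda>i. bit (ws ! i))"
proof -
  have *: "4 * card {i \<in> {..<length ws}. bit (ws ! i) l = x \<and> bit (ws ! i) l' = y} = length ws"
    if l: "l < l'" "l' < s" for l l' x y
  proof -
    have "balanced_bits (map (\<lambda>w. bit w l) ws) (map (\<lambda>w. bit w l') ws)"
      using assms l unfolding balanced_words_def sorted_wrt_iff_nth_less by simp
    then have "4 * count_list (zip (map (\<lambda>w. bit w l) ws) (map (\<lambda>w. bit w l') ws)) (x, y) = length ws"
      unfolding balanced_bits_def by (cases x; cases y) auto
    moreover have "{i \<in> {..<length ws}. zip (map (\<lambda>w. bit w l) ws) (map (\<lambda>w. bit w l') ws) ! i = (x, y)} =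
        {i \<in> {..<length ws}. bit (ws ! i) l = x \<and> bit (ws ! i) l' = y}"
      by auto
    ultimately show ?thesis by (simp add: count_list_eq_card)
  qed
  show ?thesis unfolding strength2_def
  proof (intro allI impI)
    fix l l' x y assume l: "l < s" "l' < s" "l \<noteq> l'"
    show "4 * card {i \<in> {..<length ws}. bit (ws ! i) l = x \<and> bit (ws ! i) l' = y} = card {..<length ws}"
      using *[of l l' x y] *[of l' l y x] l by (cases "l < l'") (auto simp: conj_commute)
  qed
qed

lemma count_list_concat: "count_list (concat xss) x = (\<Sum>xs\<leftarrow>xss. count_list xs x)"
  by (induction xss) auto

lemma design_exists_table:
  assumes "table_design m n s k D"
  shows "design_exists m n s k"
proof -
  define F where "F i j = bit (D ! i ! j)" for i j
  have len: "length D = m" "\<And>i. i < m \<Longrightarrow> length (D ! i) = n"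
    using assms unfolding table_design_def by (auto simp: list_all_length)
  have rows: "strength2 {..<n} s (F i)" if "i < m" for i
    using strength2_balanced_words[of s "D ! i"] assms that len
    unfolding table_design_def F_def by (auto simp: list_all_length)
  have columns: "strength2 {..<m} k (\<lambda>i. F i j)" if "j < n" for j
  proof -
    have "balanced_words k (map (\<lambda>ws. ws ! j) D)"
      using assms that unfolding table_design_def by (simp add: list_all_iff)
    from strength2_balanced_words[OF this] len
    have "strength2 {..<m} k (\<lambda>i. bit (map (\<lambda>ws. ws ! j) D ! i))" by simp
    then show ?thesis
      by (rule iffD1[OF strength2_cong, rotated]) (auto simp: F_def len)
  qed
  have uniform: "2 ^ s * card {(i, j). i < m \<and> j < n \<and> (\<forall>l<s. F i j l = v l)} = m * n" for v
  proof -
    \<comment> \<open>\<open>w\<close> encodes \<open>v\<close> on the first s bits and is 0 above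
      them, so it is among the tested numbers below 2^s and equals a truncated cell exactly if the
      cell agrees with \<open>v\<close> on these bits.\<close>
    define w :: int where "w = horner_sum of_bool 2 (map v [0..<s])"
    have bit_w: "bit w l \<longleftrightarrow> l < s \<and> v l" for l
      by (auto simp: w_def bit_horner_sum_bit_iff)
    have w: "take_bit s u = w \<longleftrightarrow> (\<forall>l<s. bit u l = v l)" for u
      by (auto simp: bit_eq_iff bit_w bit_take_bit_iff)
    have "w = take_bit s w" by (auto simp: bit_eq_iff bit_w bit_take_bit_iff)
    then have "0 \<le> w" "w < 2 ^ s"
      by (metis take_bit_nonnegative, metis take_bit_int_less_exp)
    then have "w \<in> set (map int [0..<2 ^ s])"
      by (auto intro!: image_eqI[of _ _ "nat w"] simp: nat_less_iff)
    then have "2 ^ s * count_list (map (take_bit s) (concat D)) w = length (concat D)"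
      using assms unfolding table_design_def uniform_words_def list_all_iff by fastforce
    moreover have "length (concat D) = m * n"
      using len by (simp add: length_concat sum_list_sum_nth)
    moreover have "count_list (map (take_bit s) (concat D)) w =
        (\<Sum>i<m. card {j \<in> {..<n}. \<forall>l<s. F i j l = v l})"
    proof -
      have "count_list (map (take_bit s) (concat D)) w =
          (\<Sum>ws\<leftarrow>D. count_list (map (take_bit s) ws) w)"
        unfolding map_concat count_list_concat by (simp add: o_def)
      also have "\<dots> = (\<Sum>i<m. count_list (map (take_bit s) (D ! i)) w)"
        using len by (simp add: sum_list_sum_nth atLeast0LessThan)
      also have "\<dots> = (\<Sum>i<m. card {j \<in> {..<n}. \<forall>l<s. F i j l = v l})"
      proof (rule sum.cong)
        fix i assume "i \<in> {..<m}"
        then have "{j \<in> {..<length (D ! i)}. map (take_bit s) (D ! i) ! j = w} =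
            {j \<in> {..<n}. \<forall>l<s. F i j l = v l}"
          using len by (auto simp: F_def simp flip: w)
        then show "count_list (map (take_bit s) (D ! i)) w = card {j \<in> {..<n}. \<forall>l<s. F i j l = v l}"
          by (simp add: count_list_eq_card)
      qed simp
      finally show ?thesis .
    qed
    moreover have "{(i, j). i < m \<and> j < n \<and> (\<forall>l<s. F i j l = v l)} =
        (SIGMA i:{..<m}. {j \<in> {..<n}. \<forall>l<s. F i j l = v l})" by auto
    ultimately show ?thesis by (simp add: card_SigmaI)
  qed
  have "s \<le> k" using assms unfolding table_design_def by simp
  then show ?thesis
    using rows columns uniform unfolding design_exists_def design_def by (intro exI[of _ F]) simp
qed

section \<open>The parity obstruction for four columns\<close>

text \<open>Along each edge of the cube F_2^3 the two frequencies add up to a quarter of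
  \<open>card I\<close>, so words at distance two are equally frequent. The four odd words are at
  mutual distance two, and the all-true word is one of them.\<close>

lemma strength2_parity:
  assumes "strength2 I 3 f" "finite I"
  shows "card {i \<in> I. (f i 0 \<noteq> f i 1) \<noteq> f i 2} = 4 * card {i \<in> I. f i 0 \<and> f i 1 \<and> f i 2}"
proof -
  define A where "A x y z = {i \<in> I. f i 0 = x \<and> f i 1 = y \<and> f i 2 = z}" for x y z
  define N where "N x y z = card (A x y z)" for x y z
  have fin: "finite (A x y z)" for x y z using assms(2) by (simp add: A_def)
  have "card {i \<in> I. f i 1 = y \<and> f i 2 = z} = N True y z + N False y z" for y z
    unfolding N_def
    by (subst card_Un_disjoint[symmetric, OF fin fin]) (auto simp: A_def intro!: arg_cong[of _ _ card])
  then have eq0: "4 * (N True y z + N False y z) = card I" for y z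
    using strength2D[OF assms(1), of 1 2 y z] by simp
  have "card {i \<in> I. f i 0 = x \<and> f i 2 = z} = N x True z + N x False z" for x z
    unfolding N_def
    by (subst card_Un_disjoint[symmetric, OF fin fin]) (auto simp: A_def intro!: arg_cong[of _ _ card])
  then have eq1: "4 * (N x True z + N x False z) = card I" for x z
    using strength2D[OF assms(1), of 0 2 x z] by simp
  have "card {i \<in> I. f i 0 = x \<and> f i 1 = y} = N x y True + N x y False" for x y
    unfolding N_def
    by (subst card_Un_disjoint[symmetric, OF fin fin]) (auto simp: A_def intro!: arg_cong[of _ _ card])
  then have eq2: "4 * (N x y True + N x y False) = card I" for x y
    using strength2D[OF assms(1), of 0 1 x y] by simp
  have "{i \<in> I. (f i 0 \<noteq> f i 1) \<noteq> f i 2} =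
      A True True True \<union> (A True False False \<union> (A False True False \<union> A False False True))"
    by (auto simp: A_def)
  also have "card \<dots> = N True True True + (N True False False + (N False True False + N False False True))"
    unfolding N_def
    by (subst card_Un_disjoint, simp add: fin, simp add: fin, force simp: A_def)+ simp
  also have "N True False False = N True True True"
    using eq1[of True True] eq2[of True False] by simp
  also have "N False True False = N True True True"
    using eq0[of True True] eq2[of False True] by simp
  also have "N False False True = N True True True"
    using eq0[of True True] eq1[of False True] by simp
  finally show ?thesis by (simp add: N_def A_def)
qed

text \<open>By strength 2 each row of four cells consists of words of equal parity, so each column contains
  \<open>2 c\<close> odd words; but by \<open>strength2_parity\<close> that number is a multiple of 4.\<close>

lemma no_design_rows_of_four:
  assumes "odd c"
  shows "\<not> design_exists (4 * c) 4 3 3"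
proof
  assume "design_exists (4 * c) 4 3 3"
  then obtain F where F: "design {..<4 * c} {..<4::nat} 3 3 F" unfolding design_exists_def by blast
  let ?odd = "\<lambda>i j. (F i j 0 \<noteq> F i j 1) \<noteq> F i j 2"
  define R where "R = {i \<in> {..<4 * c}. ?odd i 0}"
  have row: "{j \<in> {..<4}. ?odd i j} = (if i \<in> R then {..<4} else {})" if i: "i < 4 * c" for i
  proof -
    have st: "strength2 {..<4::nat} 3 (F i)" using F i unfolding design_def by simp
    let ?x = "card {j \<in> {..<4::nat}. F i j 0 \<and> F i j 1 \<and> F i j 2}"
    \<comment> \<open>Among four cells each pair of values occurs exactly once, so the all-true word
      occurs at most once and the number of odd words is 0 or 4.\<close>
    have "?x \<le> card {j \<in> {..<4::nat}. F i j 0 = True \<and> F i j 1 = True}"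
      by (intro card_mono) auto
    also have "\<dots> = 1" using strength2D[OF st, of 0 1 True True] by simp
    finally have "?x = 0 \<or> ?x = 1" by linarith
    then have "card {j \<in> {..<4::nat}. ?odd i j} = 0 \<or> card {j \<in> {..<4::nat}. ?odd i j} = card {..<4::nat}"
      using strength2_parity[OF st] by auto
    moreover define P where "P = {j \<in> {..<4::nat}. ?odd i j}"
    ultimately have "card P = 0 \<or> card P = card {..<4::nat}" by simp
    moreover have "P \<subseteq> {..<4}" "finite P" by (auto simp: P_def)
    ultimately have "P = {} \<or> P = {..<4}"
      using card_subset_eq[of "{..<4::nat}" P] by auto
    moreover have "i \<in> R \<longleftrightarrow> 0 \<in> P" using i by (simp add: R_def P_def)
    ultimately have "P = (if i \<in> R then {..<4} else {})" by auto
    then show ?thesis unfolding P_def .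
  qed
  define C where "C x y z = {(i, j). i \<in> {..<4 * c} \<and> j \<in> {..<4::nat} \<and> F i j 0 = x \<and> F i j 1 = y \<and> F i j 2 = z}" for x y z
  have card_C: "card (C x y z) = 2 * c" for x y z
  proof -
    have "2 ^ 3 * card {(i, j). i \<in> {..<4 * c} \<and> j \<in> {..<4::nat} \<and>
        (\<forall>l<3. F i j l = (if l = 0 then x else if l = 1 then y else z))} = 4 * c * 4"
      using F unfolding design_def by (simp only: card_lessThan)
    moreover have "(\<forall>l<3. F i j l = (if l = 0 then x else if l = 1 then y else z)) \<longleftrightarrow>
        F i j 0 = x \<and> F i j 1 = y \<and> F i j 2 = z" for i j
      by (simp add: numeral_3_eq_3 numeral_2_eq_2 less_Suc_eq all_conj_distrib imp_conjL disj_imp)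
    ultimately show ?thesis by (simp add: C_def)
  qed
  have fin: "finite (C x y z)" for x y z
    by (rule finite_subset[of _ "{..<4 * c} \<times> {..<4}"]) (auto simp: C_def)
  \<comment> \<open>Two counts of all odd cells: four for each row in \<open>R\<close>, and 2c for
    each of the four odd words.\<close>
  have "R \<times> {..<4} = {(i, j). i \<in> {..<4 * c} \<and> j \<in> {..<4::nat} \<and> ?odd i j}"
    using row by (fastforce simp: R_def split: if_splits)
  also have "\<dots> = C True True True \<union> (C True False False \<union> (C False True False \<union> C False False True))"
    by (auto simp: C_def)
  also have "card \<dots> = card (C True True True) + (card (C True False False) + (card (C False True False) + card (C False False True)))"
    by (subst card_Un_disjoint, simp add: fin, simp add: fin, force simp: C_def)+ simp
  finally have "card R = 2 * c" unfolding card_C by (simp add: card_cartesian_product)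
  moreover have "strength2 {..<4 * c} 3 (\<lambda>i. F i 0)" using F unfolding design_def by simp
  from strength2_parity[OF this] have "4 dvd card R" unfolding R_def by simp
  ultimately show False using assms by presburger
qed

section \<open>Translation between arrays and designs\<close>

text \<open>\<open>pick\<close> enumerates a set of columns increasingly, hence the assumption l <
  l'.\<close>

lemma row_submatrix_two_columns:
  assumes A: "A \<in> carrier_mat n k" and l: "l < l'" "l' < k" and i: "i < n" and v: "v \<in> carrier_vec 2"
  shows "row (submatrix A UNIV {l, l'}) i = v \<longleftrightarrow> A $$ (i, l) = v $ 0 \<and> A $$ (i, l') = v $ 1"
proof -
  have pick0: "pick {l, l'} 0 = l" using l by (auto intro!: Least_equality)
  have pick1: "pick {l, l'} (Suc 0) = l'"
    unfolding pick.simps(2) pick0 using l by (auto intro!: Least_equality)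
  have "{j. j < dim_col A \<and> j \<in> {l, l'}} = {l, l'}" using A l by auto
  then have card: "card {j. j < dim_col A \<and> j \<in> {l, l'}} = 2" using l by simp
  have "card {i. i < dim_row A \<and> i \<in> UNIV} = n" using A by simp
  then have "submatrix A UNIV {l, l'} =
      mat n 2 (\<lambda>(i, j). A $$ (pick UNIV i, pick {l, l'} j))"
    unfolding submatrix_def card by simp
  then have "row (submatrix A UNIV {l, l'}) i = vec 2 (\<lambda>j. A $$ (i, pick {l, l'} j))"
    using i by (auto simp: pick_UNIV simp del: pick.simps)
  also have "\<dots> = v \<longleftrightarrow> A $$ (i, l) = v $ 0 \<and> A $$ (i, l') = v $ 1"
    using v by (auto simp: vec_eq_iff numeral_2_eq_2 less_Suc_eq pick0 pick1 simp del: pick.simps)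
  finally show ?thesis .
qed

lemma binary_eq_iff: "a < 2 \<Longrightarrow> v < 2 \<Longrightarrow> (v = 1) = x \<Longrightarrow> a = v \<longleftrightarrow> (a = 1) = x" for a v :: nat
  by (auto simp: less_2_cases_iff)

text \<open>With two levels an entry is determined by whether it is 1. Choosing a set of two columns
  covers only the pairs l < l'; the reversed pairs follow by exchanging the two conditions.\<close>

lemma is_OA_2_2_iff:
  "is_OA n k 2 2 A \<longleftrightarrow> 2 \<le> k \<and> A \<in> carrier_mat n k \<and> (\<forall>i<n. \<forall>l<k. A $$ (i, l) < 2) \<and>
     strength2 {..<n} k (\<lambda>i l. A $$ (i, l) = 1)"
proof (cases "2 \<le> k \<and> A \<in> carrier_mat n k \<and> (\<forall>i<n. \<forall>l<k. A $$ (i, l) < 2)")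
  case True
  then have A: "A \<in> carrier_mat n k" and bin: "\<And>i l. i < n \<Longrightarrow> l < k \<Longrightarrow> A $$ (i, l) < 2" by auto
  define P where "P v x y \<longleftrightarrow> v \<in> words 2 2 \<and> (v $ 0 = 1) = x \<and> (v $ 1 = 1) = y" for v :: "nat vec" and x y
  have eq: "{i. i < n \<and> row (submatrix A UNIV {l, l'}) i = v} =
      {i \<in> {..<n}. (A $$ (i, l) = 1) = x \<and> (A $$ (i, l') = 1) = y}"
    if "P v x y" "l < l'" "l' < k" for v x y l l'
  proof -
    have v: "v \<in> carrier_vec 2" "v $ 0 < 2" "v $ 1 < 2" using that by (auto simp: P_def words_def)
    have "row (submatrix A UNIV {l, l'}) i = v \<longleftrightarrow> (A $$ (i, l) = 1) = x \<and> (A $$ (i, l') = 1) = y"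
      if "i < n" for i
    proof -
      have "A $$ (i, l) < 2" "A $$ (i, l') < 2" using bin that \<open>l < l'\<close> \<open>l' < k\<close> by auto
      then show ?thesis
        using binary_eq_iff v(2,3) \<open>P v x y\<close>
        unfolding row_submatrix_two_columns[OF A \<open>l < l'\<close> \<open>l' < k\<close> that v(1)] P_def by blast
    qed
    then show ?thesis by auto
  qed
  have ex: "\<exists>v. P v x y" for x y
    by (rule exI[of _ "vec 2 (\<lambda>j. if j = 0 then of_bool x else of_bool y)"])
      (auto simp: P_def words_def)
  show ?thesis
  proof
    assume OA: "is_OA n k 2 2 A"
    have *: "4 * card {i \<in> {..<n}. (A $$ (i, l) = 1) = x \<and> (A $$ (i, l') = 1) = y} = n"
      if l: "l < l'" "l' < k" for l l' x y
    proof -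
      obtain v where v: "P v x y" using ex by blast
      have "{l, l'} \<subseteq> {..<k}" "card {l, l'} = 2" "v \<in> words 2 2" using l v by (auto simp: P_def)
      then have "card {i. i < n \<and> row (submatrix A UNIV {l, l'}) i = v} * 2 ^ 2 = n"
        using OA unfolding is_OA_def by blast
      then show ?thesis unfolding eq[OF v l] by simp
    qed
    have "strength2 {..<n} k (\<lambda>i l. A $$ (i, l) = 1)"
      unfolding strength2_def
    proof (intro allI impI)
      fix l l' x y assume l: "l < k" "l' < k" "l \<noteq> l'"
      show "4 * card {i \<in> {..<n}. (A $$ (i, l) = 1) = x \<and> (A $$ (i, l') = 1) = y} = card {..<n}"
        using *[of l l' x y] *[of l' l y x] l by (cases "l < l'") (auto simp: conj_commute)
    qed
    then show "2 \<le> k \<and> A \<in> carrier_mat n k \<and> (\<forall>i<n. \<forall>l<k. A $$ (i, l) < 2) \<and>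
      strength2 {..<n} k (\<lambda>i l. A $$ (i, l) = 1)" using True by blast
  next
    assume "2 \<le> k \<and> A \<in> carrier_mat n k \<and> (\<forall>i<n. \<forall>l<k. A $$ (i, l) < 2) \<and>
      strength2 {..<n} k (\<lambda>i l. A $$ (i, l) = 1)"
    then have st: "strength2 {..<n} k (\<lambda>i l. A $$ (i, l) = 1)" by blast
    have "card {i. i < n \<and> row (submatrix A UNIV J) i = v} * 2 ^ 2 = n"
      if J: "J \<subseteq> {..<k}" "card J = 2" and v: "v \<in> words 2 2" for J v
    proof -
      obtain a b where "J = {a, b}" "a \<noteq> b" using J(2) by (auto simp: card_2_iff)
      then obtain l l' where l: "J = {l, l'}" "l < l'" by (metis insert_commute linorder_neqE_nat)
      with J have l': "l' < k" by auto
      define x y where "x = (v $ 0 = 1)" and "y = (v $ 1 = 1)"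
      have "P v x y" using v by (simp add: P_def x_def y_def)
      from strength2D[OF st _ l', of l x y] l(2) l'
      show ?thesis unfolding l(1) eq[OF \<open>P v x y\<close> l(2) l'] by simp
    qed
    then show "is_OA n k 2 2 A" using True unfolding is_OA_def by simp
  qed
qed (auto simp: is_OA_def)

text \<open>The conjunct 2 \<le> k is read off from the \<open>is_OA\<close> condition on the lines,
  so the array must not be empty.\<close>

lemma is_I_array_2_2_iff:
  assumes A: "A \<in> carrier_mat m n" "\<And>i j. i < m \<Longrightarrow> j < n \<Longrightarrow> A $$ (i, j) \<in> words 2 k"
    and pos: "0 < m" "0 < n"
  shows "is_I_array k m n 2 2 A \<longleftrightarrow>
    2 \<le> k \<and> design {..<m} {..<n} k k (\<lambda>i j l. A $$ (i, j) $ l = 1)"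
proof -
  have bin: "A $$ (i, j) $ l < 2" if "i < m" "j < n" "l < k" for i j l
    using A(2)[of i j] that unfolding words_def by auto
  have dim: "A $$ (i, j) \<in> carrier_vec k" if "i < m" "j < n" for i j
    using A(2)[of i j] that unfolding words_def by auto
  have rows: "is_OA n k 2 2 (row_array k A i) \<longleftrightarrow> 2 \<le> k \<and> strength2 {..<n} k (\<lambda>j l. A $$ (i, j) $ l = 1)"
    if i: "i < m" for i
  proof -
    have "strength2 {..<n} k (\<lambda>j l. row_array k A i $$ (j, l) = 1) =
        strength2 {..<n} k (\<lambda>j l. A $$ (i, j) $ l = 1)"
      by (rule strength2_cong) (use A in \<open>auto simp: row_array_def\<close>)
    then show ?thesis using A i bin unfolding is_OA_2_2_iff by (auto simp: row_array_def)
  qed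
  have columns: "is_OA m k 2 2 (col_array k A j) \<longleftrightarrow> 2 \<le> k \<and> strength2 {..<m} k (\<lambda>i l. A $$ (i, j) $ l = 1)"
    if j: "j < n" for j
  proof -
    have "strength2 {..<m} k (\<lambda>i l. col_array k A j $$ (i, l) = 1) =
        strength2 {..<m} k (\<lambda>i l. A $$ (i, j) $ l = 1)"
      by (rule strength2_cong) (use A in \<open>auto simp: col_array_def\<close>)
    then show ?thesis using A j bin unfolding is_OA_2_2_iff by (auto simp: col_array_def)
  qed
  have cells: "{(i, j). i < m \<and> j < n \<and> A $$ (i, j) = w} =
      {(i, j). i < m \<and> j < n \<and> (\<forall>l<k. (A $$ (i, j) $ l = 1) = v l)}"
    if w: "w \<in> words 2 k" "\<forall>l<k. (w $ l = 1) = v l" for w v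
  proof -
    have "A $$ (i, j) = w \<longleftrightarrow> (\<forall>l<k. (A $$ (i, j) $ l = 1) = v l)" if "i < m" "j < n" for i j
    proof -
      have "A $$ (i, j) $ l = w $ l \<longleftrightarrow> (A $$ (i, j) $ l = 1) = v l" if "l < k" for l
        using bin[OF \<open>i < m\<close> \<open>j < n\<close> that] w that unfolding words_def
        by (intro binary_eq_iff) auto
      moreover have "A $$ (i, j) = w \<longleftrightarrow> (\<forall>l<k. A $$ (i, j) $ l = w $ l)"
        using dim[OF that] w unfolding words_def by (auto simp: vec_eq_iff)
      ultimately show ?thesis by auto
    qed
    then show ?thesis by auto
  qed
  have uniform: "(\<forall>w \<in> words 2 k. card {(i, j). i < m \<and> j < n \<and> A $$ (i, j) = w} * 2 ^ k = m * n) \<longleftrightarrow>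
      (\<forall>v. 2 ^ k * card {(i, j). i < m \<and> j < n \<and> (\<forall>l<k. (A $$ (i, j) $ l = 1) = v l)} = m * n)"
  proof (intro iffI allI ballI)
    fix v :: "nat \<Rightarrow> bool"
    assume *: "\<forall>w \<in> words 2 k. card {(i, j). i < m \<and> j < n \<and> A $$ (i, j) = w} * 2 ^ k = m * n"
    let ?w = "vec k (\<lambda>l. of_bool (v l) :: nat)"
    have w: "?w \<in> words 2 k" "\<forall>l<k. (?w $ l = 1) = v l" by (auto simp: words_def)
    from bspec[OF * w(1)] show "2 ^ k * card {(i, j). i < m \<and> j < n \<and> (\<forall>l<k. (A $$ (i, j) $ l = 1) = v l)} = m * n"
      unfolding cells[OF w] by (simp add: mult.commute)
  next
    fix w
    assume *: "\<forall>v. 2 ^ k * card {(i, j). i < m \<and> j < n \<and> (\<forall>l<k. (A $$ (i, j) $ l = 1) = v l)} = m * n"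
      and w: "w \<in> words 2 k"
    from *[rule_format, of "\<lambda>l. w $ l = 1"]
    show "card {(i, j). i < m \<and> j < n \<and> A $$ (i, j) = w} * 2 ^ k = m * n"
      by (subst cells[OF w, of "\<lambda>l. w $ l = 1"]) (auto simp: mult.commute)
  qed
  show ?thesis
    unfolding is_I_array_def design_def uniform using A pos rows columns by auto
qed

lemma ex_is_I_array_2_2_iff:
  assumes "0 < m" "0 < n"
  shows "(\<exists>A. is_I_array k m n 2 2 A) \<longleftrightarrow> 2 \<le> k \<and> design_exists m n k k"
proof
  assume "\<exists>A. is_I_array k m n 2 2 A"
  then obtain A where A: "is_I_array k m n 2 2 A" by blast
  then have "A \<in> carrier_mat m n" "\<And>i j. i < m \<Longrightarrow> j < n \<Longrightarrow> A $$ (i, j) \<in> words 2 k"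
    unfolding is_I_array_def by auto
  from is_I_array_2_2_iff[OF this assms] A show "2 \<le> k \<and> design_exists m n k k"
    unfolding design_exists_def by auto
next
  assume *: "2 \<le> k \<and> design_exists m n k k"
  then obtain F where F: "design {..<m} {..<n} k k F" unfolding design_exists_def by blast
  let ?A = "mat m n (\<lambda>(i, j). vec k (\<lambda>l. of_bool (F i j l) :: nat))"
  have "design {..<m} {..<n} k k (\<lambda>i j l. ?A $$ (i, j) $ l = 1)"
    using F by (subst design_cong[where G = F]) auto
  with * have "is_I_array k m n 2 2 ?A"
    by (subst is_I_array_2_2_iff[OF _ _ assms]) (auto simp: words_def)
  then show "\<exists>A. is_I_array k m n 2 2 A" ..
qed

section \<open>Sums of signs and the Rao bound\<close>

abbreviation pm_one :: "bool \<Rightarrow> int" where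
  "pm_one b \<equiv> (if b then 1 else - 1)"

text \<open>The four sums are the 4x4 Hadamard transform of the four frequencies \<open>N\<close>.
  As it is invertible, the frequencies are all equal exactly if the first three sums vanish, which
  gives both directions between strength 2 and orthogonality of signs.\<close>

lemma sum_sign:
  fixes f g :: "'a \<Rightarrow> bool"
  assumes "finite I"
  defines "N \<equiv> \<lambda>x y. int (card {i \<in> I. f i = x \<and> g i = y})"
  shows "(\<Sum>i\<in>I. pm_one (f i)) = N True True + N True False - N False True - N False False"
    and "(\<Sum>i\<in>I. pm_one (g i)) = N True True - N True False + N False True - N False False"
    and "(\<Sum>i\<in>I. pm_one (f i) * pm_one (g i)) = N True True - N True False - N False True + N False False"
    and "int (card I) = N True True + N True False + N False True + N False False"
proof -
  have N: "N x y = (\<Sum>i\<in>I. of_bool (f i = x \<and> g i = y))" for x y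
    using assms(1) by (simp add: N_def Int_def)
  show "(\<Sum>i\<in>I. pm_one (f i)) = N True True + N True False - N False True - N False False"
    unfolding N sum.distrib[symmetric] sum_subtractf[symmetric] by (rule sum.cong) auto
  show "(\<Sum>i\<in>I. pm_one (g i)) = N True True - N True False + N False True - N False False"
    unfolding N sum.distrib[symmetric] sum_subtractf[symmetric] by (rule sum.cong) auto
  show "(\<Sum>i\<in>I. pm_one (f i) * pm_one (g i)) = N True True - N True False - N False True + N False False"
    unfolding N sum.distrib[symmetric] sum_subtractf[symmetric] by (rule sum.cong) auto
  have "int (card I) = (\<Sum>i\<in>I. 1)" by simp
  also have "\<dots> = N True True + N True False + N False True + N False False"
    unfolding N sum.distrib[symmetric] sum_subtractf[symmetric] by (rule sum.cong) auto
  finally show "int (card I) = N True True + N True False + N False True + N False False" .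
qed

lemma strength2_sum_sign:
  assumes "strength2 I s f" "finite I" "l < s" "l' < s" "l \<noteq> l'"
  shows "(\<Sum>i\<in>I. pm_one (f i l)) = 0" "(\<Sum>i\<in>I. pm_one (f i l) * pm_one (f i l')) = 0"
proof -
  note c = strength2D[OF assms(1,3,4,5)]
  have *: "4 * int (card {i \<in> I. f i l = x \<and> f i l' = y}) = int (card I)" for x y
    using c[of x y] by linarith
  show "(\<Sum>i\<in>I. pm_one (f i l)) = 0" "(\<Sum>i\<in>I. pm_one (f i l) * pm_one (f i l')) = 0"
    unfolding sum_sign(1)[OF assms(2), of "\<lambda>i. f i l" "\<lambda>i. f i l'"]
      sum_sign(3)[OF assms(2), of "\<lambda>i. f i l" "\<lambda>i. f i l'"]
    using *[of True True] *[of True False] *[of False True] *[of False False]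
    by linarith+
qed

lemma strength2I_sum_sign:
  assumes "finite I" "\<And>l. l < s \<Longrightarrow> (\<Sum>i\<in>I. pm_one (f i l)) = 0"
    "\<And>l l'. l < s \<Longrightarrow> l' < s \<Longrightarrow> l \<noteq> l' \<Longrightarrow> (\<Sum>i\<in>I. pm_one (f i l) * pm_one (f i l')) = 0"
  shows "strength2 I s f"
  unfolding strength2_def
proof (intro allI impI)
  fix l l' x y assume l: "l < s" "l' < s" "l \<noteq> l'"
  note sums = sum_sign[OF assms(1), where f = "\<lambda>i. f i l" and g = "\<lambda>i. f i l'"]
  define N where "N x y = int (card {i \<in> I. f i l = x \<and> f i l' = y})" for x y
  have "N True True + N True False - N False True - N False False = 0"
    "N True True - N True False + N False True - N False False = 0"
    "N True True - N True False - N False True + N False False = 0"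
    "int (card I) = N True True + N True False + N False True + N False False"
    unfolding N_def using sums assms(2)[OF l(1)] assms(2)[OF l(2)] assms(3)[OF l] by linarith+
  then have "4 * N True True = int (card I)" "4 * N True False = int (card I)"
    "4 * N False True = int (card I)" "4 * N False False = int (card I)"
    by linarith+
  then have "4 * N x y = int (card I)" by (cases x; cases y) simp_all
  then have "4 * int (card {i \<in> I. f i l = x \<and> f i l' = y}) = int (card I)" by (simp only: N_def)
  then show "4 * card {i \<in> I. f i l = x \<and> f i l' = y} = card I" by linarith
qed

text \<open>Extend the array of signs by a constant column. The inner products \<open>u r\<close> of its line \<open>r\<close> with
  a fixed line \<open>i\<close> satisfy \<open>u i = k + 1\<close>, and \<open>\<Sum>r. (u r)\<^sup>2 = (k + 1) |I|\<close> as columns are orthogonal.\<close>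

lemma strength2_Rao_bound:
  assumes "strength2 I k f" "finite I" "I \<noteq> {}" "2 \<le> k"
  shows "k < card I"
proof -
  define X where "X i l = (if l = k then 1 else pm_one (f i l))" for i l
  have orth: "(\<Sum>i\<in>I. X i l * X i l') = (if l = l' then int (card I) else 0)" if l: "l \<le> k" "l' \<le> k" for l l'
  proof (cases "l = l'")
    case True
    have "X i l * X i l' = 1" for i by (simp add: X_def True)
    then show ?thesis using True by simp
  next
    case False
    have single: "(\<Sum>i\<in>I. pm_one (f i p)) = 0" if "p < k" for p
    proof -
      \<comment> \<open>An arbitrary second coordinate: the vanishing of a single sum was derived
        from a pair.\<close>
      define p' :: nat where "p' = (if p = 0 then 1 else 0)"
      have "p' < k" "p \<noteq> p'" using assms(4) by (auto simp: p'_def)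
      then show ?thesis using strength2_sum_sign(1)[OF assms(1,2)] that by blast
    qed
    consider "l = k" "l' < k" | "l' = k" "l < k" | "l < k" "l' < k" using False l by linarith
    then show ?thesis
      using False single strength2_sum_sign(2)[OF assms(1,2) _ _ False]
      by cases (auto simp: X_def)
  qed
  obtain i where i: "i \<in> I" using assms(3) by blast
  define u where "u r = (\<Sum>l\<le>k. X i l * X r l)" for r
  have square: "X i l * X i l = 1" for l by (simp add: X_def)
  then have "u i = int k + 1" by (simp add: u_def)
  then have "(int k + 1)\<^sup>2 = (u i)\<^sup>2" by simp
  also have "\<dots> \<le> (\<Sum>r\<in>I. (u r)\<^sup>2)"
    by (rule member_le_sum) (use i assms(2) in auto)
  also have "\<dots> = (\<Sum>r\<in>I. \<Sum>l\<le>k. \<Sum>l'\<le>k. X i l * X i l' * (X r l * X r l'))"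
    by (simp add: u_def power2_eq_square sum_product algebra_simps)
  also have "\<dots> = (\<Sum>l\<le>k. \<Sum>r\<in>I. \<Sum>l'\<le>k. X i l * X i l' * (X r l * X r l'))"
    by (rule sum.swap)
  also have "\<dots> = (\<Sum>l\<le>k. \<Sum>l'\<le>k. \<Sum>r\<in>I. X i l * X i l' * (X r l * X r l'))"
    by (intro sum.cong refl sum.swap)
  also have "\<dots> = (\<Sum>l\<le>k. \<Sum>l'\<le>k. X i l * X i l' * (if l = l' then int (card I) else 0))"
    by (intro sum.cong refl) (simp add: orth flip: sum_distrib_left)
  also have "\<dots> = (\<Sum>l\<le>k. \<Sum>l'\<le>k. if l = l' then int (card I) else 0)"
    by (intro sum.cong refl) (auto simp: square)
  also have "\<dots> = (\<Sum>l\<le>k. int (card I))"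
    by (intro sum.cong refl) simp
  also have "\<dots> = (int k + 1) * int (card I)" by simp
  finally have "int k + 1 \<le> int (card I)" by (simp add: power2_eq_square)
  then show ?thesis by linarith
qed

section \<open>Codes defined by two parity checks\<close>

text \<open>The involutions \<open>s\<close> and \<open>t\<close> switch one of \<open>f\<close>,
  \<open>g\<close> and keep the other, so they match the four classes with each other. In the
  applications they are translations by a word.\<close>

lemma card_four_classes:
  assumes "finite A"
    and s: "\<And>x. x \<in> A \<Longrightarrow> s x \<in> A \<and> s (s x) = x \<and> f (s x) = (\<not> f x) \<and> g (s x) = g x"
    and t: "\<And>x. x \<in> A \<Longrightarrow> t x \<in> A \<and> t (t x) = x \<and> f (t x) = f x \<and> g (t x) = (\<not> g x)"
  shows "4 * card {x \<in> A. f x = a \<and> g x = b} = card A"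
proof -
  define C where "C a b = {x \<in> A. f x = a \<and> g x = b}" for a b
  have fin: "finite (C a b)" for a b using assms(1) by (simp add: C_def)
  have "bij_betw s (C True b) (C False b)" for b
    by (rule bij_betw_byWitness[where f' = s]) (auto simp: C_def s)
  then have s_eq: "card (C True b) = card (C False b)" for b by (rule bij_betw_same_card)
  have "bij_betw t (C a True) (C a False)" for a
    by (rule bij_betw_byWitness[where f' = t]) (auto simp: C_def t)
  then have t_eq: "card (C a True) = card (C a False)" for a by (rule bij_betw_same_card)
  have "A = C True True \<union> (C True False \<union> (C False True \<union> C False False))"
    by (auto simp: C_def)
  then have "card A = card (C True True \<union> (C True False \<union> (C False True \<union> C False False)))"
    by (rule arg_cong)
  also have "\<dots> = card (C True True) + (card (C True False) + (card (C False True) + card (C False False)))"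
    by (subst card_Un_disjoint, simp add: fin, simp add: fin, force simp: C_def)+ simp
  also have "\<dots> = 4 * card (C a b)"
    using s_eq[of True] s_eq[of False] t_eq[of True] t_eq[of False] by (cases a; cases b) simp_all
  finally show ?thesis by (simp add: C_def)
qed

text \<open>Subsets of the coordinates stand for binary words: \<open>sym_diff\<close> is addition,
  and \<open>parity P\<close> is the inner product over F_2 with the indicator of P.\<close>

definition parity :: "nat set \<Rightarrow> nat set \<Rightarrow> bool" where
  "parity P X \<longleftrightarrow> odd (card (X \<inter> P))"

lemma parity_sym_diff:
  assumes "finite P"
  shows "parity P (sym_diff X Y) \<longleftrightarrow> parity P X \<noteq> parity P Y"
proof -
  let ?X = "X \<inter> P" and ?Y = "Y \<inter> P"
  have fin: "finite ?X" "finite ?Y" using assms by auto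
  have "sym_diff X Y \<inter> P = (?X - ?Y) \<union> (?Y - ?X)" by auto
  then have "card (sym_diff X Y \<inter> P) = card (?X - ?Y) + card (?Y - ?X)"
    using card_Un_disjoint[of "?X - ?Y" "?Y - ?X"] fin by auto
  moreover have "card ?X = card (?X - ?Y) + card (?X \<inter> ?Y)"
    using card_Int_Diff[OF fin(1), of ?Y] by simp
  moreover have "card ?Y = card (?Y - ?X) + card (?X \<inter> ?Y)"
    using card_Int_Diff[OF fin(2), of ?X] by (simp add: Int_commute)
  ultimately show ?thesis unfolding parity_def by presburger
qed

lemma parity_empty: "\<not> parity P {}"
  by (simp add: parity_def)

lemma parity_singleton: "parity P {x} \<longleftrightarrow> x \<in> P"
  by (cases "x \<in> P") (simp_all add: parity_def)

definition even_code :: "nat \<Rightarrow> nat set \<Rightarrow> nat set \<Rightarrow> nat set set" where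
  "even_code k P Q = {X \<in> Pow {..<k}. \<not> parity P X \<and> \<not> parity Q X}"

text \<open>The dual of the code consists of \<open>P\<close>, \<open>Q\<close>, their symmetric difference and the empty set, so
  that these three sets having at least three elements is what strength 2 requires.\<close>

locale parity_pair =
  fixes k :: nat and P Q :: "nat set"
  assumes P: "P \<subseteq> {..<k}" "3 \<le> card P"
    and Q: "Q \<subseteq> {..<k}" "3 \<le> card Q"
    and PQ: "3 \<le> card (sym_diff P Q)"
begin

lemma finite_PQ: "finite P" "finite Q"
  using P(1) Q(1) finite_subset by blast+

text \<open>Each of P, Q and their symmetric difference keeps an element after removing l and l', so
  no nonzero functional on F_2^2 vanishes on the attainable pairs of parities. These pairs form a
  subspace, which is therefore everything.\<close>

lemma ex_parity: "\<exists>E. E \<subseteq> {..<k} - {l, l'} \<and> parity P E = a \<and> parity Q E = b"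
proof -
  define R where "R a b \<longleftrightarrow> (\<exists>E. E \<subseteq> {..<k} - {l, l'} \<and> parity P E = a \<and> parity Q E = b)" for a b
  have zero: "R False False" unfolding R_def by (rule exI[of _ "{}"]) (simp add: parity_empty)
  have add: "R (a \<noteq> a') (b \<noteq> b')" if "R a b" "R a' b'" for a b a' b'
  proof -
    obtain E E' where "E \<subseteq> {..<k} - {l, l'}" "parity P E = a" "parity Q E = b"
      "E' \<subseteq> {..<k} - {l, l'}" "parity P E' = a'" "parity Q E' = b'"
      using \<open>R a b\<close> \<open>R a' b'\<close> unfolding R_def by blast
    then show ?thesis
      unfolding R_def using parity_sym_diff[OF finite_PQ(1)] parity_sym_diff[OF finite_PQ(2)]
      by (intro exI[of _ "sym_diff E E'"]) auto
  qed
  have single: "\<exists>x\<in>U. R (x \<in> P) (x \<in> Q)" if U: "U \<subseteq> {..<k}" "3 \<le> card U" for U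
  proof -
    have "card U - card {l, l'} \<le> card (U - {l, l'})" by (rule diff_card_le_card_Diff) simp
    moreover have "card {l, l'} \<le> 2" by (simp add: card_insert_if)
    ultimately have "card (U - {l, l'}) \<noteq> 0" using U(2) by linarith
    then obtain x where "x \<in> U" "x \<notin> {l, l'}" by (metis card.empty all_not_in_conv DiffE)
    then show ?thesis
      using U(1) unfolding R_def
      by (intro bexI[of _ x] exI[of _ "{x}"]) (auto simp: parity_singleton)
  qed
  obtain x where "R x True" using single[OF Q] by force
  obtain y where "R True y" using single[OF P] by force
  have "R True False \<or> R False True" using single[OF _ PQ] P(1) Q(1) by force
  then have "R a b"
  proof
    assume "R True False"
    with add[OF \<open>R x True\<close> this] \<open>R x True\<close> zero show ?thesis by (cases x; cases a; cases b) auto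
  next
    assume "R False True"
    with add[OF \<open>R True y\<close> this] \<open>R True y\<close> zero show ?thesis by (cases y; cases a; cases b) auto
  qed
  then show ?thesis unfolding R_def .
qed

lemma card_even_code: "4 * card (even_code k P Q) = 2 ^ k"
proof -
  obtain D E where "D \<subseteq> {..<k}" "parity P D" "\<not> parity Q D" "E \<subseteq> {..<k}" "\<not> parity P E" "parity Q E"
    \<comment> \<open>Only the parities matter here; the coordinate 0 to be avoided is
      arbitrary.\<close>
    using ex_parity[of 0 0 True False] ex_parity[of 0 0 False True] by blast
  then have "4 * card {X \<in> Pow {..<k}. parity P X = False \<and> parity Q X = False} = card (Pow {..<k})"
    using parity_sym_diff[OF finite_PQ(1)] parity_sym_diff[OF finite_PQ(2)]
    by (intro card_four_classes[where s = "\<lambda>X. sym_diff X D" and t = "\<lambda>X. sym_diff X E"]) auto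
  then show ?thesis by (simp add: even_code_def card_Pow)
qed

lemma finite_even_code: "finite (even_code k P Q)"
  unfolding even_code_def by (rule finite_subset[of _ "Pow {..<k}"]) auto

text \<open>Correcting the singleton of p by a word of the same parities that avoids p and p' gives
  a codeword containing p but not p'. Translations by such codewords permute the code and switch one
  coordinate at a time.\<close>

lemma strength2_even_code: "strength2 (even_code k P Q) k (\<lambda>X l. l \<in> X)"
  unfolding strength2_def
proof (intro allI impI)
  fix l l' x y assume l: "l < k" "l' < k" "l \<noteq> l'"
  have ex: "\<exists>D. D \<in> even_code k P Q \<and> p \<in> D \<and> p' \<notin> D" if "p < k" "p \<noteq> p'" for p p'
  proof -
    obtain E where E: "E \<subseteq> {..<k} - {p, p'}" "parity P E = (p \<in> P)" "parity Q E = (p \<in> Q)"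
      using ex_parity[of p p' "p \<in> P" "p \<in> Q"] by blast
    have "\<not> parity P (sym_diff {p} E)" "\<not> parity Q (sym_diff {p} E)"
      unfolding parity_sym_diff[OF finite_PQ(1)] parity_sym_diff[OF finite_PQ(2)] E(2,3) parity_singleton
      by simp_all
    then have "sym_diff {p} E \<in> even_code k P Q"
      using E(1) that unfolding even_code_def by auto
    then show ?thesis using E that by (intro exI[of _ "sym_diff {p} E"]) auto
  qed
  obtain D E where D: "D \<in> even_code k P Q" "l \<in> D" "l' \<notin> D" and E: "E \<in> even_code k P Q" "l' \<in> E" "l \<notin> E"
    using ex[of l l'] ex[of l' l] l by metis
  have closed: "sym_diff X Y \<in> even_code k P Q"
    if "X \<in> even_code k P Q" "Y \<in> even_code k P Q" for X Y
    using that by (auto simp: even_code_def parity_sym_diff finite_PQ)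
  show "4 * card {X \<in> even_code k P Q. (l \<in> X) = x \<and> (l' \<in> X) = y} = card (even_code k P Q)"
    using D E closed finite_even_code
    by (intro card_four_classes[where s = "\<lambda>X. sym_diff X D" and t = "\<lambda>X. sym_diff X E"]) auto
qed

lemma design_even_code:
  assumes st: "strength2 I k f" "finite I"
    and balanced: "\<And>a b. 4 * card {i \<in> I. parity P {l. f i l} = a \<and> parity Q {l. f i l} = b} = card I"
  shows "design I (even_code k P Q) k k (\<lambda>i X l. f i l \<noteq> (l \<in> X))"
proof -
  let ?C = "even_code k P Q"
  have rows: "strength2 ?C k (\<lambda>X l. f i l \<noteq> (l \<in> X))" for i
    by (rule strength2_flip[OF strength2_even_code, where e = "f i"]) auto
  have columns: "strength2 I k (\<lambda>i l. f i l \<noteq> (l \<in> X))" for X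
    by (rule strength2_flip[OF st(1), where e = "\<lambda>l. l \<in> X"]) auto
  have uniform: "2 ^ k * card {(i, X). i \<in> I \<and> X \<in> ?C \<and> (\<forall>l<k. (f i l \<noteq> (l \<in> X)) = v l)} =
      card I * card ?C" for v
  proof -
    \<comment> \<open>\<open>Y i\<close> is the sum of row \<open>i\<close> and \<open>v\<close>, so
      it is the only candidate X with value \<open>v\<close> in cell (i, X). It lies in the code
      exactly if row \<open>i\<close> has the parities of \<open>v\<close>, which holds for a
      quarter of the rows.\<close>
    define Y where "Y i = {l \<in> {..<k}. f i l \<noteq> v l}" for i
    define a b where "a = parity P {l. v l}" and "b = parity Q {l. v l}"
    have parity_Y: "parity U (Y i) \<longleftrightarrow> parity U {l. f i l} \<noteq> parity U {l. v l}" if "U \<subseteq> {..<k}" for U i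
    proof -
      have "finite U" using that finite_subset by blast
      moreover have "Y i \<inter> U = sym_diff {l. f i l} {l. v l} \<inter> U" using that by (auto simp: Y_def)
      then have "parity U (Y i) = parity U (sym_diff {l. f i l} {l. v l})" by (simp add: parity_def)
      ultimately show ?thesis by (simp add: parity_sym_diff)
    qed
    have "Y i \<in> ?C \<longleftrightarrow> parity P {l. f i l} = a \<and> parity Q {l. f i l} = b" for i
      using P(1) Q(1) unfolding a_def b_def by (auto simp: even_code_def parity_Y) (auto simp: Y_def)
    moreover have "{(i, X). i \<in> I \<and> X \<in> ?C \<and> (\<forall>l<k. (f i l \<noteq> (l \<in> X)) = v l)} =
        (\<lambda>i. (i, Y i)) ` {i \<in> I. Y i \<in> ?C}"
    proof -
      have "(\<forall>l<k. (f i l \<noteq> (l \<in> X)) = v l) \<longleftrightarrow> X = Y i" if "X \<subseteq> {..<k}" for i X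
        using that by (auto simp: Y_def)
      then show ?thesis by (auto simp: even_code_def)
    qed
    ultimately have "4 * card {(i, X). i \<in> I \<and> X \<in> ?C \<and> (\<forall>l<k. (f i l \<noteq> (l \<in> X)) = v l)} = card I"
      using balanced[of a b] by (simp add: card_image inj_on_def)
    then show ?thesis by (simp flip: card_even_code)
  qed
  show ?thesis
    unfolding design_def using rows columns uniform st(2) finite_even_code by auto
qed

end

section \<open>Designs from Hadamard matrices\<close>

text \<open>The transpose divided by n is a right inverse of the matrix, hence a left inverse. The
  division requires passing from integers to a field.\<close>

lemma hadamard_column_orthogonal:
  assumes H: "hadamard n H" and ab: "a < n" "b < n"
  shows "(\<Sum>i<n. H $$ (i, a) * H $$ (i, b)) = (if a = b then int n else 0)"
proof -
  have carr: "H \<in> carrier_mat n n" and HH: "H * transpose_mat H = int n \<cdot>\<^sub>m 1\<^sub>m n"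
    using H unfolding hadamard_def by auto
  define R :: "real mat" where "R = map_mat of_int H"
  define S where "S = (1 / real n) \<cdot>\<^sub>m transpose_mat R"
  have R: "R \<in> carrier_mat n n" and S: "S \<in> carrier_mat n n" using carr by (auto simp: R_def S_def)
  have n: "real n \<noteq> 0" using ab by simp
  have "R * S = 1\<^sub>m n"
  proof (rule eq_matI)
    fix i j assume "i < dim_row (1\<^sub>m n)" "j < dim_col (1\<^sub>m n)"
    then have ij: "i < n" "j < n" by auto
    have "(\<Sum>l<n. H $$ (i, l) * H $$ (j, l)) = (H * transpose_mat H) $$ (i, j)"
      using carr ij by (simp add: scalar_prod_def atLeast0LessThan)
    also have "\<dots> = (if i = j then int n else 0)" unfolding HH using ij by simp
    finally have "real_of_int (\<Sum>l<n. H $$ (i, l) * H $$ (j, l)) = (if i = j then real n else 0)"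
      by simp
    moreover have "(R * S) $$ (i, j) = (\<Sum>l<n. real_of_int (H $$ (i, l)) * (real_of_int (H $$ (j, l)) / real n))"
      using carr ij by (simp add: R_def S_def scalar_prod_def atLeast0LessThan)
    moreover have "\<dots> = real_of_int (\<Sum>l<n. H $$ (i, l) * H $$ (j, l)) / real n"
      by (simp add: sum_divide_distrib)
    ultimately show "(R * S) $$ (i, j) = 1\<^sub>m n $$ (i, j)" using ij n by simp
  qed (use R S in auto)
  then have "S * R = 1\<^sub>m n" by (rule mat_mult_left_right_inverse[OF R S])
  then have "(S * R) $$ (a, b) = (if a = b then 1 else 0)" using ab by simp
  moreover have "(S * R) $$ (a, b) = (\<Sum>i<n. real_of_int (H $$ (i, a)) / real n * real_of_int (H $$ (i, b)))"
    using carr ab by (simp add: R_def S_def scalar_prod_def atLeast0LessThan)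
  moreover have "\<dots> = real_of_int (\<Sum>i<n. H $$ (i, a) * H $$ (i, b)) / real n"
    by (simp add: sum_divide_distrib)
  ultimately have "real_of_int (\<Sum>i<n. H $$ (i, a) * H $$ (i, b)) = (if a = b then real n else 0)"
    using n by (simp add: field_simps split: if_splits)
  then show ?thesis by (metis (mono_tags, lifting) of_int_0_eq_iff of_int_eq_iff of_int_of_nat_eq)
qed

text \<open>The sum of a column is its inner product with the constant column 0. The shift
  \<open>Suc l\<close> accounts for the deletion of that column.\<close>

lemma strength2_hadamard:
  assumes H: "hadamard n H" "normalized H"
  shows "strength2 {..<n} (n - 1) (\<lambda>i l. H $$ (i, Suc l) = 1)"
proof (rule strength2I_sum_sign)
  have carr: "H \<in> carrier_mat n n" and entries: "\<And>i j. i < n \<Longrightarrow> j < n \<Longrightarrow> H $$ (i, j) \<in> {1, - 1}"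
    using H unfolding hadamard_def by auto
  have sgn: "pm_one (H $$ (i, Suc l) = 1) = H $$ (i, Suc l)" if "i < n" "l < n - 1" for i l
    using entries[of i "Suc l"] that by auto
  fix l assume l: "l < n - 1"
  have "(\<Sum>i<n. pm_one (H $$ (i, Suc l) = 1)) = (\<Sum>i<n. H $$ (i, 0) * H $$ (i, Suc l))"
  proof (rule sum.cong)
    fix i assume "i \<in> {..<n}"
    then show "pm_one (H $$ (i, Suc l) = 1) = H $$ (i, 0) * H $$ (i, Suc l)"
      using H(2) carr l sgn unfolding normalized_def by simp
  qed simp
  then show "(\<Sum>i<n. pm_one (H $$ (i, Suc l) = 1)) = 0"
    using hadamard_column_orthogonal[OF H(1), of 0 "Suc l"] l by simp
  fix l' assume l': "l' < n - 1" "l \<noteq> l'"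
  have "(\<Sum>i<n. pm_one (H $$ (i, Suc l) = 1) * pm_one (H $$ (i, Suc l') = 1)) =
      (\<Sum>i<n. H $$ (i, Suc l) * H $$ (i, Suc l'))"
    using l l' by (intro sum.cong) (simp_all only: sgn lessThan_iff)
  then show "(\<Sum>i<n. pm_one (H $$ (i, Suc l) = 1) * pm_one (H $$ (i, Suc l') = 1)) = 0"
    using hadamard_column_orthogonal[OF H(1), of "Suc l" "Suc l'"] l l' by simp
qed simp

lemma weight_eq_card:
  assumes "dim_vec v = n" "\<And>i. i < n \<Longrightarrow> v $ i = 1 \<longleftrightarrow> p i"
  shows "weight v = card {i \<in> {..<n}. p i}"
  unfolding weight_def using assms by (intro arg_cong[of _ _ card]) auto

text \<open>The hypothesis speaks of sets of column vectors, the code of sets of coordinates below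
  k. \<open>T\<close> turns vectors into column indices in \<open>J\<close>, and \<open>P\<close>
  turns these into positions in an enumeration \<open>e\<close> of k columns including
  \<open>J\<close>. The bounds on k are the size of \<open>J\<close> and the number of columns
  available.\<close>

lemma design_exists_good_hadamard:
  assumes good: "good_hadamard_order m" and "0 < m" and k: "8 \<le> k" "k \<le> 4 * m - 1"
  shows "design_exists (4 * m) (2 ^ (k - 2)) k k"
proof -
  define n where "n = 4 * m"
  have n: "0 < n" using \<open>0 < m\<close> by (simp add: n_def)
  obtain H J B V W v w where H: "hadamard n H" "normalized H"
    and J: "J \<subseteq> {..<n - 1}" "card J = 8"
    and B: "B = submatrix (hadamard_OA H) UNIV J"
    and VW: "V \<subseteq> set (cols B)" "W \<subseteq> set (cols B)" "3 \<le> card V" "3 \<le> card W"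
    and v: "v \<in> V - W" and w: "w \<in> W - V" and vw: "V - {v} \<noteq> W - {w}"
    and orth: "orthogonal_binary (sum_mod2 n V) (sum_mod2 n W)"
    using good unfolding good_hadamard_order_def n_def by blast
  have carr: "H \<in> carrier_mat n n" and entries: "\<And>i j. i < n \<Longrightarrow> j < n \<Longrightarrow> H $$ (i, j) \<in> {1, - 1}"
    using H unfolding hadamard_def by auto
  define h where "h i l \<longleftrightarrow> H $$ (i, Suc l) = 1" for i l
  have st: "strength2 {..<n} (n - 1) h"
    using strength2_hadamard[OF H] unfolding h_def .
  define c where "c l = vec n (\<lambda>i. of_bool (h i l) :: nat)" for l
  have cols: "set (cols B) \<subseteq> c ` J"
  proof
    fix x assume "x \<in> set (cols B)"
    then obtain j where j: "j < dim_col B" "x = col B j" by (auto simp: cols_def)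
    have dim: "dim_row B = n" "dim_col B = card {j. j < n - 1 \<and> j \<in> J}"
      unfolding B dim_submatrix using carr by (auto simp: hadamard_OA_def)
    have "{j. j < n - 1 \<and> j \<in> J} = J" using J(1) by auto
    then have jJ: "j < card J" using j(1) dim by simp
    then have pick: "pick J j \<in> J" by (rule pick_in_set_le)
    have "x = c (pick J j)"
    proof (rule eq_vecI)
      show "dim_vec x = dim_vec (c (pick J j))" using j dim by (simp add: c_def)
      fix i assume "i < dim_vec (c (pick J j))"
      then have i: "i < n" by (simp add: c_def)
      have "x $ i = hadamard_OA H $$ (pick UNIV i, pick J j)"
        unfolding j(2) using i j(1) dim submatrix_index[of i "hadamard_OA H" UNIV j J]
        unfolding B by (auto simp: dim_submatrix)
      also have "\<dots> = c (pick J j) $ i"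
        using i pick J(1) carr entries[of i "Suc (pick J j)"]
        by (auto simp: pick_UNIV hadamard_OA_def c_def h_def)
      finally show "x $ i = c (pick J j) $ i" .
    qed
    then show "x \<in> c ` J" using pick by blast
  qed
  have inj: "inj_on c J"
  proof (rule inj_onI, rule ccontr)
    fix l l' assume l: "l \<in> J" "l' \<in> J" "c l = c l'" "l \<noteq> l'"
    \<comment> \<open>Equal columns would never show the pair (True, False), which strength 2
      requires in n / 4 rows.\<close>
    have "h i l = h i l'" if "i < n" for i
      using arg_cong[OF l(3), of "\<lambda>x. x $ i"] that by (simp add: c_def of_bool_def split: if_splits)
    then have "{i \<in> {..<n}. h i l = True \<and> h i l' = False} = {}" by auto
    moreover have "l < n - 1" "l' < n - 1" using J(1) l(1,2) by auto
    moreover from this have "4 * card {i \<in> {..<n}. h i l = True \<and> h i l' = False} = card {..<n}"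
      by (rule strength2D[OF st _ _ l(4)])
    ultimately show False using n by (simp only: card.empty) simp
  qed
  define T where "T U = {l \<in> J. c l \<in> U}" for U
  have T_image: "c ` T U = U" if "U \<subseteq> set (cols B)" for U
    using that cols by (auto simp: T_def)
  have T_inj: "inj_on c (T U)" for U
    using inj by (rule inj_on_subset) (auto simp: T_def)
  have T_card: "card (T U) = card U" if "U \<subseteq> set (cols B)" for U
    using card_image[OF T_inj, of U] T_image[OF that] by simp
  have finJ: "finite J" using J(1) finite_subset by blast
  have fin: "finite (T U)" for U using finJ by (simp add: T_def)
  \<comment> \<open>\<open>p U i\<close> is entry \<open>i\<close> of the sum of the vectors in
    \<open>U\<close> over F_2, and also the inner product of row \<open>i\<close> with the indicator
    of \<open>T U\<close>.\<close>
  define p where "p U i \<longleftrightarrow> odd (card {l \<in> T U. h i l})" for U i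
  have sum: "sum_mod2 n U $ i = 1 \<longleftrightarrow> p U i" if U: "U \<subseteq> set (cols B)" and i: "i < n" for U i
  proof -
    have "(\<Sum>x\<in>U. x $ i) = (\<Sum>x\<in>c ` T U. x $ i)" using T_image[OF U] by simp
    also have "\<dots> = (\<Sum>l\<in>T U. of_bool (h i l))"
      unfolding sum.reindex[OF T_inj] using i by (simp add: c_def)
    also have "\<dots> = card {l \<in> T U. h i l}" using fin by (simp add: Int_def)
    finally show ?thesis using i by (simp add: sum_mod2_def p_def odd_iff_mod_2_eq_one)
  qed
  have balanced: "4 * card {i \<in> {..<n}. p V i = a \<and> p W i = b} = n" for a b
  proof -
    obtain r where r: "sum_mod2 n V \<in> words 2 (4 * r)" "weight (sum_mod2 n V) = 2 * r"
      "weight (sum_mod2 n W) = 2 * r"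
      "card {i. i < 4 * r \<and> sum_mod2 n V $ i = 1 \<and> sum_mod2 n W $ i = 1} = r"
      using orth unfolding orthogonal_binary_def by blast
    \<comment> \<open>Comparing lengths identifies the existential parameter as n / 4. The two
      weights and the size of the common support then determine all four classes.\<close>
    have nr: "n = 4 * r" using r(1) by (auto simp: words_def sum_mod2_def)
    define C where "C x y = {i \<in> {..<n}. p V i = x \<and> p W i = y}" for x y
    have finC: "finite (C x y)" for x y by (simp add: C_def)
    have "{i. i < 4 * r \<and> sum_mod2 n V $ i = 1 \<and> sum_mod2 n W $ i = 1} = C True True"
      using sum[OF VW(1)] sum[OF VW(2)] by (auto simp: C_def nr)
    then have TT: "card (C True True) = r" using r(4) by simp
    have V: "card {i \<in> {..<n}. p V i} = 2 * r" and W: "card {i \<in> {..<n}. p W i} = 2 * r"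
      using r(2,3) weight_eq_card[of "sum_mod2 n V" n "p V"] weight_eq_card[of "sum_mod2 n W" n "p W"]
        sum[OF VW(1)] sum[OF VW(2)] by (auto simp: sum_mod2_def)
    have "{i \<in> {..<n}. p V i} = C True True \<union> C True False" by (auto simp: C_def)
    moreover have "card (C True True \<union> C True False) = card (C True True) + card (C True False)"
      by (rule card_Un_disjoint[OF finC finC]) (auto simp: C_def)
    ultimately have TF: "card (C True False) = r" using V TT by simp
    have "{i \<in> {..<n}. p W i} = C True True \<union> C False True" by (auto simp: C_def)
    moreover have "card (C True True \<union> C False True) = card (C True True) + card (C False True)"
      by (rule card_Un_disjoint[OF finC finC]) (auto simp: C_def)
    ultimately have FT: "card (C False True) = r" using W TT by simp
    have "{..<n} = {i \<in> {..<n}. p V i} \<union> (C False True \<union> C False False)" by (auto simp: C_def)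
    then have "n = card ({i \<in> {..<n}. p V i} \<union> (C False True \<union> C False False))"
      by (metis card_lessThan)
    also have "\<dots> = card {i \<in> {..<n}. p V i} + card (C False True \<union> C False False)"
      by (rule card_Un_disjoint) (auto simp: C_def)
    also have "card (C False True \<union> C False False) = card (C False True) + card (C False False)"
      by (rule card_Un_disjoint[OF finC finC]) (auto simp: C_def)
    finally have "card (C False False) = r" using V FT nr by simp
    with TF FT have "card (C a b) = r" using TT by (cases a; cases b) simp_all
    then show ?thesis using nr by (simp add: C_def)
  qed
  have sym_diff_card: "3 \<le> card (sym_diff (T V) (T W))"
  proof -
    \<comment> \<open>If v and w made up the whole symmetric difference, removing them would leave
      the intersection of V and W on both sides.\<close>
    obtain x where x: "x \<in> sym_diff V W" "x \<noteq> v" "x \<noteq> w" using v w vw by blast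
    have "sym_diff V W \<subseteq> c ` sym_diff (T V) (T W)"
      using VW(1,2) cols by (auto simp: T_def)
    moreover have "{v, w, x} \<subseteq> sym_diff V W" using v w x by blast
    ultimately have "card {v, w, x} \<le> card (c ` sym_diff (T V) (T W))"
      using fin by (intro card_mono) auto
    moreover have "card (c ` sym_diff (T V) (T W)) \<le> card (sym_diff (T V) (T W))" using fin by (intro card_image_le) auto
    moreover have "v \<noteq> w" using v w by blast
    then have "card {v, w, x} = 3" using x by simp
    ultimately show ?thesis by simp
  qed
  obtain L where L: "J \<subseteq> L" "L \<subseteq> {..<n - 1}" "card L = k"
    using exists_subset_between[of J k "{..<n - 1}"] J k by (auto simp: n_def)
  then obtain e where e: "bij_betw e {..<k} L"
    using ex_bij_betw_nat_finite[of L] finite_subset[OF L(2)] by (auto simp: atLeast0LessThan)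
  define P where "P U = {l \<in> {..<k}. e l \<in> T U}" for U
  have e_bij: "bij_betw e {l \<in> {..<k}. e l \<in> U} U" if "U \<subseteq> J" for U
    using e that L(1) unfolding bij_betw_def by (fastforce intro: inj_on_subset)
  have card_e: "card {l \<in> {..<k}. e l \<in> U} = card U" if "U \<subseteq> J" for U
    using e_bij[OF that] by (rule bij_betw_same_card)
  have T_J: "T U \<subseteq> J" for U by (auto simp: T_def)
  interpret parity_pair k "P V" "P W"
  proof
    show "3 \<le> card (P V)" "3 \<le> card (P W)"
      using VW T_card card_e[OF T_J] unfolding P_def by auto
    have "sym_diff (P V) (P W) = {l \<in> {..<k}. e l \<in> sym_diff (T V) (T W)}" by (auto simp: P_def)
    moreover have "sym_diff (T V) (T W) \<subseteq> J" using T_J by blast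
    ultimately show "3 \<le> card (sym_diff (P V) (P W))"
      using sym_diff_card card_e[of "sym_diff (T V) (T W)"] by simp
  qed (auto simp: P_def)
  have parity: "parity (P U) {l. h i (e l)} = p U i" for U i
  proof -
    have "{l. h i (e l)} \<inter> P U = {l \<in> {..<k}. e l \<in> {l \<in> T U. h i l}}" by (auto simp: P_def)
    then have "card ({l. h i (e l)} \<inter> P U) = card {l \<in> T U. h i l}"
      using card_e[of "{l \<in> T U. h i l}"] T_J[of U] by auto
    then show ?thesis by (simp add: parity_def p_def)
  qed
  have "strength2 {..<n} k (\<lambda>i l. h i (e l))"
    unfolding strength2_def
  proof (intro allI impI)
    fix l l' x y assume "l < k" "l' < k" "l \<noteq> l'"
    then have "e l < n - 1" "e l' < n - 1" "e l \<noteq> e l'"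
      using e L(2) by (auto simp: bij_betw_def inj_on_def)
    from strength2D[OF st this]
    show "4 * card {i \<in> {..<n}. h i (e l) = x \<and> h i (e l') = y} = card {..<n}" .
  qed
  then have "design {..<n} (even_code k (P V) (P W)) k k (\<lambda>i X l. h i (e l) \<noteq> (l \<in> X))"
    using balanced by (intro design_even_code) (simp_all add: parity)
  from design_imp_design_exists[OF this]
  have "design_exists n (card (even_code k (P V) (P W))) k k" by simp
  moreover have "k = 2 + (k - 2)" using k by simp
  then have "(2 :: nat) ^ k = 2 ^ 2 * 2 ^ (k - 2)" by (metis power_add)
  then have "card (even_code k (P V) (P W)) = 2 ^ (k - 2)"
    using card_even_code by simp
  ultimately show ?thesis by (simp add: n_def)
qed

section \<open>The tables and the sufficiency of the conditions\<close>

text \<open>The tables of sizes 8, 12 were found by simulated annealing.\<close>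

lemma design_exists_4_4: "design_exists 4 4 2 3"
proof (rule design_exists_table)
  \<comment> \<open>The addition table of the even-weight words 0, 3, 5, 6 of F_2^3.\<close>
  show "table_design 4 4 2 3
    [[0, 3, 5, 6],
     [3, 0, 6, 5],
     [5, 6, 0, 3],
     [6, 5, 3, 0]]"
    by code_simp
qed

lemma design_exists_8_8: "design_exists 8 8 5 7"
proof (rule design_exists_table)
  show "table_design 8 8 5 7
    [[24, 13, 27, 14, 21, 0, 22, 3],
     [23, 100, 114, 1, 124, 15, 25, 106],
     [126, 107, 125, 104, 115, 102, 112, 101],
     [113, 2, 20, 103, 26, 105, 127, 12],
     [66, 94, 71, 91, 73, 85, 76, 80],
     [77, 81, 72, 84, 70, 90, 67, 95],
     [43, 56, 46, 61, 32, 51, 37, 54],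
     [36, 55, 33, 50, 47, 60, 42, 57]]"
    by code_simp
qed

lemma design_exists_12_8: "design_exists 12 8 5 7"
proof (rule design_exists_table)
  show "table_design 12 8 5 7
    [[18, 25, 12, 0, 7, 11, 30, 21],
     [20, 31, 10, 19, 1, 24, 13, 6],
     [78, 69, 80, 28, 91, 23, 2, 9],
     [40, 35, 54, 79, 61, 68, 81, 90],
     [124, 0, 105, 70, 26, 115, 53, 111],
     [89, 86, 35, 37, 48, 106, 108, 63],
     [59, 46, 61, 104, 84, 65, 71, 50],
     [119, 120, 17, 62, 98, 45, 107, 100],
     [15, 115, 122, 117, 105, 38, 32, 92],
     [98, 109, 100, 43, 119, 94, 88, 113],
     [65, 52, 71, 114, 46, 125, 59, 40],
     [37, 74, 95, 89, 76, 48, 118, 67]]"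
    by code_simp
qed

text \<open>Since 144 = 2^4 * 9, no s above 4 is possible, and k \<le> a + 2 asks for no more at a =
  2. With s = k the design may be transposed.\<close>

lemma design_exists_12_12: "design_exists 12 12 4 4"
proof (rule design_exists_table)
  show "table_design 12 12 4 4
    [[12, 14, 3, 15, 5, 9, 4, 7, 2, 10, 0, 9],
     [1, 2, 10, 4, 13, 7, 15, 14, 4, 9, 3, 8],
     [2, 11, 5, 8, 9, 4, 1, 2, 15, 7, 12, 14],
     [13, 7, 12, 3, 10, 11, 6, 0, 14, 0, 9, 5],
     [4, 2, 1, 9, 12, 8, 10, 5, 3, 15, 6, 15],
     [7, 8, 6, 13, 3, 1, 0, 4, 13, 11, 14, 10],
     [1, 4, 13, 7, 14, 2, 10, 9, 11, 12, 7, 0],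
     [15, 12, 6, 1, 7, 2, 13, 11, 8, 1, 10, 4],
     [10, 9, 15, 4, 0, 14, 3, 8, 5, 6, 13, 3],
     [6, 1, 0, 10, 6, 15, 12, 3, 8, 5, 11, 13],
     [8, 15, 11, 2, 0, 5, 9, 14, 6, 12, 5, 3],
     [11, 5, 8, 14, 11, 12, 7, 13, 1, 2, 0, 6]]"
    by code_simp
qed

lemma design_exists_four_times_odd:
  assumes "design_exists 12 n s k" "design_exists 8 n s k" "odd m" "3 \<le> m"
  shows "design_exists (4 * m) n s k"
proof (cases "m = 3")
  case False
  \<comment> \<open>The case m = 3 is separate because the number of stacked copies has to be
    positive.\<close>
  define r where "r = (m - 3) div 2"
  have m: "4 * m = 12 + r * 8" "0 < r"
    using assms(3,4) False unfolding r_def by presburger+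
  show ?thesis
    unfolding m(1) by (intro design_exists_add_rows design_exists_mult_rows assms m)
qed (use assms in simp)

text \<open>Both side lengths have the form 12 + 8r, so blocks of sizes 12x12, 12x8, 8x12 and 8x8
  are stacked in both directions; transposition allows only rows to be stacked.\<close>

lemma design_exists_4_4_odd:
  assumes "odd m" "3 \<le> m" "odd b" "3 \<le> b"
  shows "design_exists (4 * m) (4 * b) 4 4"
proof -
  have "design_exists 8 8 4 4" "design_exists 12 8 4 4"
    using design_exists_8_8 design_exists_12_8 design_exists_mono by fastforce+
  then have "design_exists 12 (4 * m) 4 4" "design_exists 8 (4 * m) 4 4"
    using design_exists_four_times_odd[OF _ _ assms(1,2)] design_exists_12_12 design_exists_transpose
    by blast+
  then show ?thesis
    using design_exists_four_times_odd[OF _ _ assms(3,4)] design_exists_transpose by blast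
qed

lemma design_exists_sufficient:
  assumes good: "\<And>m'. odd m' \<Longrightarrow> m' \<ge> 3 \<Longrightarrow> good_hadamard_order m'"
    and odd: "odd m" "odd b" and a: "2 \<le> a"
    and k: "2 \<le> k" "k \<le> a + 2" "k < 4 * m" "k < 2 ^ a * b"
    and exc: "\<not> (k = 3 \<and> a = 2 \<and> b = 1)" "\<not> (k = 3 \<and> a = 2 \<and> m = 1)"
  shows "design_exists (4 * m) (2 ^ a * b) k k"
proof -
  have pos: "0 < m" "0 < b" using odd odd_pos by auto
  \<comment> \<open>Copies placed side by side reduce the task to 2^c columns for some c \<le>
    a.\<close>
  have extend: ?thesis if "design_exists (4 * m) (2 ^ c) k k" "c \<le> a" for c
  proof -
    have "2 ^ a * b = (2 ^ (a - c) * b) * (2 :: nat) ^ c"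
      using that(2) by (simp flip: power_add)
    then show ?thesis
      using design_exists_mult_columns[OF that(1), of "2 ^ (a - c) * b"] pos(2) by (simp add: mult_ac)
  qed
  show ?thesis
  proof (cases "k = 2")
    case True
    have "design_exists 4 4 2 2" by (rule design_exists_mono[OF design_exists_4_4]) simp_all
    from design_exists_mult_rows[OF this pos(1)] show ?thesis
      using a True by (intro extend[of 2]) (simp_all add: mult.commute)
  next
    case k2: False
    show ?thesis
    proof (cases "m = 1")
      case True
      \<comment> \<open>Here k < 4, and the second exception excludes a = 2; so there is room for
        one doubling of the 4x4 table.\<close>
      then have "k = 3" "3 \<le> a" using k k2 a exc(2) by auto
      moreover have "design_exists 4 (2 * 4) (Suc 2) 3"
        by (rule design_exists_double[OF design_exists_4_4]) simp_all
      ultimately show ?thesis using True by (intro extend[of 3]) simp_all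
    next
      case False
      then have m: "3 \<le> m" using odd(1) pos by (auto elim!: oddE)
      show ?thesis
      proof (cases "a = 2")
        case True
        \<comment> \<open>For b = 1 the bound k < 4 would leave only the excluded k = 3.\<close>
        have "b \<noteq> 1" using True k k2 exc(1) by auto
        then have "3 \<le> b" using odd(2) pos by (auto elim!: oddE)
        then have "design_exists (4 * m) (4 * b) 4 4" using design_exists_4_4_odd m odd by blast
        then show ?thesis using True k by (auto intro: design_exists_mono)
      next
        case False
        then have a3: "3 \<le> a" using a by simp
        have d5: "design_exists (4 * m) 8 5 7"
          using design_exists_four_times_odd design_exists_12_8 design_exists_8_8 odd(1) m by blast
        have d6: "design_exists (4 * m) (2 * 8) (Suc 5) 7"
          by (rule design_exists_double[OF d5]) simp_all
        have d7: "design_exists (4 * m) (2 * (2 * 8)) (Suc (Suc 5)) 7"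
          by (rule design_exists_double[OF d6]) simp_all
        \<comment> \<open>The bound k \<le> a + 2 ensures that the 8, 16, 32 or 2^(k-2) columns used
          in the four cases divide 2^a.\<close>
        consider "k \<le> 5" | "k = 6" | "k = 7" | "8 \<le> k" by linarith
        then show ?thesis
        proof cases
          case 1
          then have "design_exists (4 * m) 8 k k" by (intro design_exists_mono[OF d5]) simp_all
          then show ?thesis using a3 by (intro extend[of 3]) simp_all
        next
          case 2
          have "design_exists (4 * m) 16 6 6"
            using design_exists_mono[OF d6, of 6 6] by simp
          then show ?thesis using 2 k by (intro extend[of 4]) simp_all
        next
          case 3
          then show ?thesis using d7 k by (intro extend[of 5]) simp_all
        next
          case 4
          then show ?thesis
            using good[OF odd(1) m] k pos
            by (intro extend[of "k - 2"] design_exists_good_hadamard) simp_all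
        qed
      qed
    qed
  qed
qed

section \<open>Necessary conditions and the characterization\<close>

lemma le_if_two_power_dvd:
  assumes "2 ^ k dvd 2 ^ a * (b :: nat)" "odd b"
  shows "k \<le> a"
proof -
  have "coprime (2 ^ k) b" using assms(2) by simp
  then have "(2 :: nat) ^ k dvd 2 ^ a" using assms(1) coprime_dvd_mult_left_iff by blast
  then show ?thesis by (simp add: dvd_power_iff_le)
qed

lemma is_OA_2_2_bounds:
  assumes "is_OA n k 2 2 A" "0 < n"
  shows "2 \<le> k" "k < n" "4 dvd n"
proof -
  have st: "2 \<le> k" "strength2 {..<n} k (\<lambda>i l. A $$ (i, l) = 1)"
    using assms(1) unfolding is_OA_2_2_iff by auto
  then show "2 \<le> k" "k < n"
    using strength2_Rao_bound[OF st(2)] assms(2) by auto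
  have "4 * card {i \<in> {..<n}. (A $$ (i, 0) = 1) = True \<and> (A $$ (i, 1) = 1) = True} = card {..<n}"
    by (rule strength2D[OF st(2)]) (use st(1) in auto)
  then show "4 dvd n" unfolding card_lessThan by (rule dvdI[OF sym])
qed

lemma no_I_array_exceptional:
  assumes "odd c"
  shows "\<not> is_I_array 3 (4 * c) 4 2 2 A" "\<not> is_I_array 3 4 (4 * c) 2 2 A"
proof -
  have "0 < c" using assms odd_pos by blast
  then show "\<not> is_I_array 3 (4 * c) 4 2 2 A" "\<not> is_I_array 3 4 (4 * c) 2 2 A"
    using ex_is_I_array_2_2_iff[of "4 * c" 4 3] ex_is_I_array_2_2_iff[of 4 "4 * c" 3]
      no_design_rows_of_four[OF assms] design_exists_transpose by auto
qed

lemma is_I_array_imp_admissible: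
  assumes "is_I_array k m n q t A" "0 < m" "0 < n" "0 < q"
  shows "admissible (k, m, n, q, t)"
proof -
  have "vec k (\<lambda>_. 0) \<in> words q k" using assms(4) by (simp add: words_def)
  then have "card {(i, j). i < m \<and> j < n \<and> A $$ (i, j) = vec k (\<lambda>_. 0)} * q ^ k = m * n"
    using assms(1) unfolding is_I_array_def by blast
  then have "q ^ k dvd m * n"
    by (intro dvdI[of _ _ "card {(i, j). i < m \<and> j < n \<and> A $$ (i, j) = vec k (\<lambda>_. 0)}"])
      (simp add: mult.commute)
  moreover have "is_OA n k q t (row_array k A 0)" "is_OA m k q t (col_array k A 0)"
    using assms unfolding is_I_array_def by auto
  ultimately show ?thesis by auto
qed

theorem theorem8:
  fixes m b a k :: nat
  assumes "\<And>m'. odd m' \<Longrightarrow> m' \<ge> 3 \<Longrightarrow> good_hadamard_order m'"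
    and "odd m" and "odd b"
  shows "(\<exists>A. is_I_array k (4 * m) (2 ^ a * b) 2 2 A) \<longleftrightarrow>
         admissible (k, 4 * m, 2 ^ a * b, 2, 2) \<and>
         (k, 4 * m, 2 ^ a * b, 2, 2) \<notin>
           {(3, 4 * c, 4, 2 :: nat, 2 :: nat) | c. odd c} \<union> {(3, 4, 4 * c, 2, 2) | c. odd c}"
    (is "?L \<longleftrightarrow> ?adm \<and> ?exc")
proof
  have pos: "0 < 4 * m" "0 < 2 ^ a * b" using assms(2,3) odd_pos by auto
  {
    assume ?L
    then obtain A where A: "is_I_array k (4 * m) (2 ^ a * b) 2 2 A" by blast
    have ?adm using is_I_array_imp_admissible[OF A pos] by simp
    moreover have ?exc using A no_I_array_exceptional by (auto; blast)
    ultimately show "?adm \<and> ?exc" by blast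
  next
    assume *: "?adm \<and> ?exc"
    then obtain A A' where A: "is_OA (4 * m) k 2 2 A" and A': "is_OA (2 ^ a * b) k 2 2 A'"
      and dvd: "2 ^ k dvd 4 * m * (2 ^ a * b)" by auto
    \<comment> \<open>The bound on a is hidden in the existence of an orthogonal array: strength 2
      makes its size a multiple of 4.\<close>
    have "2 ^ 2 dvd 2 ^ a * b" using is_OA_2_2_bounds(3)[OF A' pos(2)] by simp
    then have "2 \<le> a" using le_if_two_power_dvd assms(3) by blast
    moreover have "2 ^ k dvd 2 ^ (a + 2) * (m * b)" using dvd by (simp add: power_add algebra_simps)
    then have "k \<le> a + 2" using le_if_two_power_dvd assms(2,3) by fastforce
    \<comment> \<open>The exceptions arise with c = m if the row length is 4, and with c = b if the
      column length is 4.\<close>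
    moreover have "\<not> (k = 3 \<and> a = 2 \<and> b = 1)" "\<not> (k = 3 \<and> a = 2 \<and> m = 1)"
      using * assms(2,3) by auto
    ultimately have "design_exists (4 * m) (2 ^ a * b) k k"
      using is_OA_2_2_bounds[OF A pos(1)] is_OA_2_2_bounds[OF A' pos(2)]
      by (intro design_exists_sufficient assms) auto
    then show ?L
      using ex_is_I_array_2_2_iff[OF pos] is_OA_2_2_bounds(1)[OF A pos(1)] by blast
  }
qed

end
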